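(* Let $(X_u)_{u\in\mathcal T_\infty}$ be the vertex reinforced branching random walk (VRBRW) on $\mathbb Z$ with offspring distribution $\mu$ and non-decreasing weight function $w:\mathbb N\to(0,\infty)$. Let $\mathcal R=\{x\in\mathbb Z: Z_\infty(x)>0\}$ be the set of sites ever visited and $\mathcal R'=\{x\in\mathbb Z: Z_\infty(x)=\infty\}$ the set of sites visited infinitely often. If $\sum_{n\ge 0}\frac{1}{w(n)}<\infty$, then $$\mathbb P(|\mathcal R|<\infty)=1\quad\text{and}\quad \mathbb P(|\mathcal R'|=2)>0.$$
   Context: $\mathbb N=\{0,1,2,\dots\}$. Let $\mu$ be a probability measure on $\mathbb N$ with mean one and variance $\sigma^2=\sum_{i\ge1} i(i-1)\mu(i)\in(0,\infty)$. Kesten's tree $\mathcal T_\infty$ associated with $\mu$: vertices are either normal or special; all vertices reproduce independently; normal vertices have a number of children with law $\mu$, all normal; special vertices have a number of children with the size-biased law $\widetilde\mu(i)=i\mu(i)$, and among the children of a special vertex one chosen uniformly at random is special while the others are normal. The root $\emptyset$ is special. For $u\in\mathcal T_\infty$, $|u|$ is its generation (with $|\emptyset|=0$) and $\mathcal V(u)$ is its set of children. Set $\mathcal T_n=\{u\in\mathcal T_\infty:|u|\le n\}$ and $\partial\mathcal T_n=\{u\in\mathcal T_\infty:|u|=n\}$. VRBRW on $\mathbb Z$: let $w:\mathbb N\to(0,\infty)$ be non-decreasing (the weight function). The process $(X_u)_{u\in\mathcal T_\infty}$ takes values in $\mathbb Z$, with $X_\emptyset=0$. For $n\in\mathbb N\cup\{\infty\}$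 and $x\in\mathbb Z$ the local time is $Z_n(x)=\sum_{u\in\mathcal T_n}\mathbf 1\{X_u=x\}$. Let $\mathcal F_n=\sigma(\mathcal T_n,(X_u)_{u\in\mathcal T_n})$. Conditionally on $\mathcal F_n$ and on the tree, the positions of the vertices of generation $n+1$ are independent, and for $u\in\partial\mathcal T_n$, $v\in\mathcal V(u)$, on the event $\{X_u=x\}$, $$\mathbb P(X_v=x\pm1\mid\mathcal F_n,\mathcal V(u))=\frac{w(Z_n(x\pm1))}{w(Z_n(x-1))+w(Z_n(x+1))}.$$ *)

theory Defs
  imports "HOL-Probability.Probability"
begin

section \<open>Offspring laws\<close>

locale critical_offspring =
  fixes \<mu> :: "nat pmf"
  assumes mean_one: "measure_pmf.expectation \<mu> real = 1"
    and variance_summable: "summable (\<lambda>i. real i * (real i - 1) * pmf \<mu> i)"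
    and variance_pos: "0 < (\<Sum>i. real i * (real i - 1) * pmf \<mu> i)"

text \<open>\<open>embed_pmf\<close> is only meaningful for functions of total mass one; this is where
  the mean-one assumption is needed, see \<open>pmf_size_biased\<close>.\<close>

definition size_biased :: "nat pmf \<Rightarrow> nat pmf" where
  "size_biased \<mu> = embed_pmf (\<lambda>i. real i * pmf \<mu> i)"

lemma (in critical_offspring) pmf_size_biased:
  "pmf (size_biased \<mu>) i = real i * pmf \<mu> i"
  unfolding size_biased_def
proof (rule pmf_embed_pmf)
  have int: "integrable (measure_pmf \<mu>) real"
    using mean_one not_integrable_integral_eq by fastforce
  have "(\<integral>\<^sup>+i. ennreal (real i * pmf \<mu> i) \<partial>count_space UNIV)
      = (\<integral>\<^sup>+i. ennreal (pmf \<mu> i) * ennreal (real i) \<partial>count_space UNIV)"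
    by (simp add: ennreal_mult' mult.commute)
  also have "\<dots> = (\<integral>\<^sup>+i. ennreal (real i) \<partial>measure_pmf \<mu>)"
    by (simp add: nn_integral_measure_pmf)
  also have "\<dots> = 1"
    using int mean_one by (subst nn_integral_eq_integral) auto
  finally show "(\<integral>\<^sup>+i. ennreal (real i * pmf \<mu> i) \<partial>count_space UNIV) = 1" .
qed simp

text \<open>The reproduction of a special vertex: its number of children, together with the index
  of the special one among them. The case \<open>k = 0\<close>, where \<open>pmf_of_set\<close> is unspecified, has
  probability zero under \<open>size_biased \<mu>\<close>.\<close>

definition special_law :: "nat pmf \<Rightarrow> (nat \<times> nat) pmf" where
  "special_law \<mu> = do {
     k \<leftarrow> size_biased \<mu>;
     j \<leftarrow> pmf_of_set {..<k};
     return_pmf (k, j)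
   }"


section \<open>Trees with special vertices\<close>

text \<open>Vertices are Ulam--Harris labels: the root is \<open>[]\<close>, and the children of \<open>u\<close> are
  \<open>u @ [i]\<close> for \<open>i\<close> below the number of children of \<open>u\<close>. Every label \<open>u\<close> carries a triple
  \<open>(m, k, j)\<close>: as a normal vertex, \<open>u\<close> has \<open>m\<close> children; as a special vertex, it has \<open>k\<close>
  children, of which the one with index \<open>j\<close> is special.\<close>

type_synonym vertex = "nat list"
type_synonym reproduction = "nat \<times> nat \<times> nat"

inductive special :: "(vertex \<Rightarrow> reproduction) \<Rightarrow> vertex \<Rightarrow> bool" for r where
  root: "special r []"
| child: "special r u \<Longrightarrow> r u = (m, k, j) \<Longrightarrow> special r (u @ [j])"

definition num_children :: "(vertex \<Rightarrow> reproduction) \<Rightarrow> vertex \<Rightarrow> nat" where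
  "num_children r u = (case r u of (m, k, j) \<Rightarrow> if special r u then k else m)"

inductive_set tree :: "(vertex \<Rightarrow> reproduction) \<Rightarrow> vertex set" for r where
  root: "[] \<in> tree r"
| child: "u \<in> tree r \<Longrightarrow> i < num_children r u \<Longrightarrow> u @ [i] \<in> tree r"

definition truncate :: "vertex set \<Rightarrow> enat \<Rightarrow> vertex set" where
  "truncate T n = {u \<in> T. enat (length u) \<le> n}"


section \<open>Local times\<close>

definition local_time :: "vertex set \<Rightarrow> (vertex \<Rightarrow> int) \<Rightarrow> enat \<Rightarrow> int \<Rightarrow> enat" where
  "local_time T X n x =
     (let A = {u \<in> truncate T n. X u = x} in if finite A then enat (card A) else \<infinity>)"

definition visited :: "vertex set \<Rightarrow> (vertex \<Rightarrow> int) \<Rightarrow> int set" where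
  "visited T X = {x. local_time T X \<infinity> x > 0}"

definition visited_infinitely :: "vertex set \<Rightarrow> (vertex \<Rightarrow> int) \<Rightarrow> int set" where
  "visited_infinitely T X = {x. local_time T X \<infinity> x = \<infinity>}"

lemma finite_truncate_tree: "finite (truncate (tree r) (enat n))"
proof (induction n)
  case 0
  have "truncate (tree r) (enat 0) \<subseteq> {[]}"
    by (auto simp: truncate_def)
  then show ?case
    by (rule finite_subset) simp
next
  case (Suc n)
  have "truncate (tree r) (enat (Suc n)) \<subseteq>
      insert [] (\<Union>u \<in> truncate (tree r) (enat n). (\<lambda>i. u @ [i]) ` {..<num_children r u})"
  proof
    fix v assume v: "v \<in> truncate (tree r) (enat (Suc n))"
    then have "v \<in> tree r" by (simp add: truncate_def)
    then show "v \<in> insert [] (\<Union>u \<in> truncate (tree r) (enat n).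
        (\<lambda>i. u @ [i]) ` {..<num_children r u})"
      by cases (use v in \<open>auto simp: truncate_def\<close>)
  qed
  then show ?case
    by (rule finite_subset) (use Suc in auto)
qed

text \<open>Consequently \<open>the_enat\<close> loses nothing in the following definition.\<close>

lemma local_time_finite: "local_time (tree r) X (enat n) x \<noteq> \<infinity>"
  using finite_truncate_tree[of r n] by (auto simp: local_time_def Let_def)

definition step_prob ::
  "(nat \<Rightarrow> real) \<Rightarrow> vertex set \<Rightarrow> (vertex \<Rightarrow> int) \<Rightarrow> nat \<Rightarrow> int \<Rightarrow> int \<Rightarrow> real" where
  "step_prob w T X n x y =
     (let Z = (\<lambda>z. the_enat (local_time T X (enat n) z)) in
      if y = x - 1 \<or> y = x + 1 then w (Z y) / (w (Z (x - 1)) + w (Z (x + 1))) else 0)"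


section \<open>Kesten's tree\<close>

locale kesten_tree = prob_space M + critical_offspring \<mu>
  for M :: "'a measure" and \<mu> :: "nat pmf" +
  fixes \<xi> :: "vertex \<Rightarrow> 'a \<Rightarrow> reproduction"
  assumes indep_reproduction: "indep_vars (\<lambda>_. count_space UNIV) \<xi> UNIV"
    and distr_reproduction:
      "\<And>u. distr M (count_space UNIV) (\<xi> u) = measure_pmf (pair_pmf \<mu> (special_law \<mu>))"

definition kesten :: "(vertex \<Rightarrow> 'a \<Rightarrow> reproduction) \<Rightarrow> 'a \<Rightarrow> vertex set" where
  "kesten \<xi> \<omega> = tree (\<lambda>u. \<xi> u \<omega>)"

definition kesten_special :: "(vertex \<Rightarrow> 'a \<Rightarrow> reproduction) \<Rightarrow> 'a \<Rightarrow> vertex set" where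
  "kesten_special \<xi> \<omega> = {u \<in> kesten \<xi> \<omega>. special (\<lambda>u. \<xi> u \<omega>) u}"


section \<open>Vertex reinforced branching random walk\<close>

text \<open>The sigma-algebra generated by the whole tree with its special vertices and by the
  positions of the vertices of generation at most \<open>n\<close>. Positions are defined for all labels,
  but only those of vertices of the tree are observed.\<close>

definition history ::
  "'a measure \<Rightarrow> (vertex \<Rightarrow> 'a \<Rightarrow> reproduction) \<Rightarrow> (vertex \<Rightarrow> 'a \<Rightarrow> int) \<Rightarrow> nat \<Rightarrow> 'a measure" where
  "history M \<xi> X n = sigma (space M)
     (range (\<lambda>u. {\<omega> \<in> space M. u \<in> kesten \<xi> \<omega>}) \<union>
      range (\<lambda>u. {\<omega> \<in> space M. u \<in> kesten_special \<xi> \<omega>}) \<union>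
      range (\<lambda>(u, x). {\<omega> \<in> space M. u \<in> truncate (kesten \<xi> \<omega>) (enat n) \<and> X u \<omega> = x}))"

text \<open>\<open>transition\<close> expresses conditional independence and the conditional marginals together:
  it gives the joint conditional law of the positions of any finitely many vertices of
  generation \<open>n + 1\<close>. The parent of \<open>v\<close> is \<open>butlast v\<close>.\<close>

locale vrbrw = kesten_tree M \<mu> \<xi>
  for M :: "'a measure" and \<mu> :: "nat pmf" and \<xi> :: "vertex \<Rightarrow> 'a \<Rightarrow> reproduction" +
  fixes w :: "nat \<Rightarrow> real" and X :: "vertex \<Rightarrow> 'a \<Rightarrow> int"
  assumes weight_pos: "\<And>n. 0 < w n"
    and weight_mono: "mono w"
    and measurable_position: "\<And>u. X u \<in> M \<rightarrow>\<^sub>M count_space UNIV"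
    and position_root: "\<And>\<omega>. \<omega> \<in> space M \<Longrightarrow> X [] \<omega> = 0"
    and transition: "\<And>n V y. finite V \<Longrightarrow> (\<And>v. v \<in> V \<Longrightarrow> length v = Suc n) \<Longrightarrow>
      AE \<omega> in M. V \<subseteq> kesten \<xi> \<omega> \<longrightarrow>
        real_cond_exp M (history M \<xi> X n) (indicator {\<omega>' \<in> space M. \<forall>v\<in>V. X v \<omega>' = y v}) \<omega> =
        (\<Prod>v\<in>V. step_prob w (kesten \<xi> \<omega>) (\<lambda>u. X u \<omega>) n (X (butlast v) \<omega>) (y v))"

text \<open>\<open>real_cond_exp\<close> is a genuine conditional expectation only with respect to a
  subalgebra.\<close>

lemma special_snoc: "special r (u @ [i]) \<longleftrightarrow> special r u \<and> i = snd (snd (r u))"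
  by (auto elim: special.cases intro: special.child[where m = "fst (r u)" and k = "fst (snd (r u))"])

lemma tree_snoc: "u @ [i] \<in> tree r \<longleftrightarrow> u \<in> tree r \<and> i < num_children r u"
  by (auto elim: tree.cases intro: tree.child)

lemma (in kesten_tree) measurable_reproduction [measurable]: "\<xi> u \<in> M \<rightarrow>\<^sub>M count_space UNIV"
  using indep_reproduction by (auto simp: indep_vars_def)

lemma (in kesten_tree) measurable_pred_reproduction:
  "Measurable.pred M (\<lambda>\<omega>. P (\<xi> u \<omega>))"
  by (rule measurable_compose[OF measurable_reproduction]) simp

lemma (in kesten_tree) measurable_special [measurable]:
  "Measurable.pred M (\<lambda>\<omega>. special (\<lambda>u. \<xi> u \<omega>) u)"
proof (induction u rule: rev_induct)
  case Nil
  then show ?case by (simp add: special.root)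
next
  case (snoc i u)
  note [measurable] = snoc measurable_pred_reproduction[of "\<lambda>t. i = snd (snd t)" u]
  show ?case unfolding special_snoc by measurable
qed

lemma (in kesten_tree) measurable_kesten [measurable]:
  "Measurable.pred M (\<lambda>\<omega>. u \<in> kesten \<xi> \<omega>)"
  unfolding kesten_def
proof (induction u rule: rev_induct)
  case Nil
  then show ?case by (simp add: tree.root)
next
  case (snoc i u)
  note [measurable] = snoc measurable_pred_reproduction[of "\<lambda>t. i < fst (snd t)" u]
    measurable_pred_reproduction[of "\<lambda>t. i < fst t" u]
  have "i < num_children r u \<longleftrightarrow>
      (special r u \<and> i < fst (snd (r u))) \<or> (\<not> special r u \<and> i < fst (r u))" for r
    by (simp add: num_children_def case_prod_beta)
  then show ?case unfolding tree_snoc by simp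
qed

lemma (in vrbrw) subalgebra_history: "subalgebra M (history M \<xi> X n)"
proof -
  note [measurable] = measurable_position
  show ?thesis
    unfolding subalgebra_def history_def kesten_special_def truncate_def
    by (auto simp: sets_measure_of_conv space_measure_of_conv intro!: sets.sigma_sets_subset)
qed

end

(* Fix a set H of sites and the vertices of a generation lying on its boundary. As long as the walk
   stays in H, a boundary site x is entered only from its neighbour z inside H, and a child of a
   vertex at x leaves H with probability p = w(0) / (w(0) + w(Z(z))). The number of vertices at x in
   one generation is at most the offspring of those at z in the previous one, whose mean is at most m
   per vertex (m bounds the means of both offspring laws) times G(z), the size of that generation at z.
   Hence the expected exits caused by it are at most a constant times w(0) * G(z) / w(Z(z)), and these
   quantities sum to at most w(0) * sum 1/w(k), deterministically. Exponentiating, the potential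
   1{still in H} * exp (- 2 m * load + 2 m^2 * accumulated intake) is a submartingale, which bounds
   the probability of never leaving H from below by a constant depending only on the current load.

   With H = {..y+1} at the first visit to y the load vanishes, so that the probability of ever
   reaching y + 2 is at most (1 - c) times that of reaching y, and the range is almost surely finite.
   With H = {0, 1} at time 0, the walk stays in {0, 1} with positive probability, and there the parity
   of the generation shows that both sites are visited infinitely often. *)

theory Submission
  imports Defs
begin

section \<open>Preliminaries\<close>

text \<open>Two obstacles shape the proof. \<open>history\<close> contains the whole tree, so
  conditioning on it reveals all future offspring, whereas the submartingale property holds only
  after averaging over the next offspring. The averaging requires that, given the tree up to
  generation \<open>n\<close>, the positions up to \<open>n\<close> carry no information about the
  rest of the tree. It is carried out on the countably many fibres of finite states, without
  conditional expectations. Moreover, finite variance gives the size-biased law a finite mean but no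
  exponential moments, so the exponent has to be linear in the offspring numbers and is averaged by
  a tangent-line bound. The factor 2 in the potential comes from
  \<open>1 - p \<ge> exp (- (2 * p))\<close> for \<open>p \<le> 1 / 2\<close>, and monotonicity of
  \<open>w\<close> keeps exit probabilities below 1/2. A vertex on the boundary pays one factor
  \<open>m\<close> for its children; a vertex next to it pays \<open>m\<close> twice, for its
  children and for theirs. The distance 2 between \<open>y\<close> and \<open>y + 2\<close> keeps
  the constant independent of how many vertices reach \<open>y\<close> together.\<close>

lemma nn_integral_mono_fibres:
  assumes S: "S \<in> M \<rightarrow>\<^sub>M count_space A" and A: "countable A"
    and [measurable]: "f \<in> borel_measurable M" "g \<in> borel_measurable M"
    and le: "\<And>s. s \<in> A \<Longrightarrow> (\<integral>\<^sup>+\<omega>. f \<omega> * indicator {\<omega> \<in> space M. S \<omega> = s} \<omega> \<partial>M) \<le>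
        (\<integral>\<^sup>+\<omega>. g \<omega> * indicator {\<omega> \<in> space M. S \<omega> = s} \<omega> \<partial>M)"
  shows "(\<integral>\<^sup>+\<omega>. f \<omega> \<partial>M) \<le> (\<integral>\<^sup>+\<omega>. g \<omega> \<partial>M)"
proof -
  have in_sets [measurable]: "{\<omega> \<in> space M. S \<omega> = s} \<in> sets M" if "s \<in> A" for s
    using measurable_sets[OF S, of "{s}"] that by (auto simp: vimage_def Int_def conj_commute)
  \<comment> \<open>Disintegration along the countably many values of \<open>S\<close>. It replaces
    conditioning: an inequality between integrals may be checked on each fibre.\<close>
  have decomp: "(\<integral>\<^sup>+\<omega>. h \<omega> \<partial>M) =
      (\<integral>\<^sup>+s. (\<integral>\<^sup>+\<omega>. h \<omega> * indicator {\<omega> \<in> space M. S \<omega> = s} \<omega> \<partial>M) \<partial>count_space A)"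
    if [measurable]: "h \<in> borel_measurable M" for h
  proof -
    have "(\<integral>\<^sup>+\<omega>. h \<omega> \<partial>M) =
        (\<integral>\<^sup>+\<omega>. (\<integral>\<^sup>+s. h \<omega> * indicator {\<omega> \<in> space M. S \<omega> = s} \<omega> \<partial>count_space A) \<partial>M)"
    proof (rule nn_integral_cong)
      fix \<omega> assume \<omega>: "\<omega> \<in> space M"
      then have SA: "S \<omega> \<in> A" using measurable_space[OF S] by simp
      have "(\<integral>\<^sup>+s. h \<omega> * indicator {\<omega> \<in> space M. S \<omega> = s} \<omega> \<partial>count_space A) =
          (\<integral>\<^sup>+s. h \<omega> * indicator {S \<omega>} s \<partial>count_space A)"
        using \<omega> by (intro nn_integral_cong) (auto simp: indicator_def)
      also have "\<dots> = h \<omega>"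
        using SA by (subst nn_integral_cmult_indicator) auto
      finally show "h \<omega> = (\<integral>\<^sup>+s. h \<omega> * indicator {\<omega> \<in> space M. S \<omega> = s} \<omega> \<partial>count_space A)" ..
    qed
    also have "\<dots> = (\<integral>\<^sup>+s. (\<integral>\<^sup>+\<omega>. h \<omega> * indicator {\<omega> \<in> space M. S \<omega> = s} \<omega> \<partial>M) \<partial>count_space A)"
      using A by (intro nn_integral_count_space_nn_integral) auto
    finally show ?thesis .
  qed
  show ?thesis
    unfolding decomp[of f, OF assms(3)] decomp[of g, OF assms(4)] by (intro nn_integral_mono le) auto
qed

text \<open>The new summand is spread over the block of \<open>g N\<close> integers ending at the
  new partial sum. As \<open>w\<close> is largest at the end of the block, each of them contributes
  at least as much to the series of \<open>1 / w k\<close>. The blocks are disjoint and start at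
  1.\<close>

lemma sum_inverse_weight_le:
  fixes w :: "nat \<Rightarrow> real" and g :: "nat \<Rightarrow> nat"
  assumes "mono w" "\<And>n. 0 < w n"
  shows "(\<Sum>j<N. real (g j) / w (\<Sum>i\<le>j. g i)) \<le> (\<Sum>k<Suc (\<Sum>j<N. g j). 1 / w k)"
proof (induction N)
  case 0
  then show ?case using assms(2)[of 0] by simp
next
  case (Suc N)
  let ?z = "\<Sum>j<N. g j"
  have "real (g N) / w (?z + g N) = (\<Sum>k\<in>{Suc ?z..<Suc (?z + g N)}. 1 / w (?z + g N))" by simp
  also have "\<dots> \<le> (\<Sum>k\<in>{Suc ?z..<Suc (?z + g N)}. 1 / w k)"
    using assms by (intro sum_mono divide_left_mono) (auto intro: monoD)
  finally have "real (g N) / w (?z + g N) \<le> (\<Sum>k\<in>{Suc ?z..<Suc (?z + g N)}. 1 / w k)" .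
  moreover have "(\<Sum>k<Suc (?z + g N). 1 / w k) =
      (\<Sum>k<Suc ?z. 1 / w k) + (\<Sum>k\<in>{Suc ?z..<Suc (?z + g N)}. 1 / w k)"
    by (subst sum.union_disjoint[symmetric]) (auto intro!: sum.cong simp del: sum.lessThan_Suc)
  moreover have "(\<Sum>i\<le>N. g i) = ?z + g N" by (simp add: lessThan_Suc_atMost[symmetric])
  ultimately show ?case using Suc by simp
qed

lemma one_minus_ge_exp:
  fixes p :: real
  assumes "0 \<le> p" "p \<le> 1 / 2"
  shows "exp (- (2 * p)) \<le> 1 - p"
proof -
  have "1 \<le> (1 - p) * (1 + 2 * p)"
    using mult_nonneg_nonneg[of p "1 - 2 * p"] assms by (simp add: algebra_simps)
  also have "\<dots> \<le> (1 - p) * exp (2 * p)"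
    using assms by (intro mult_left_mono) auto
  finally show ?thesis by (simp add: exp_minus field_simps)
qed

lemma butlast_tree: "u \<in> tree r \<Longrightarrow> u \<noteq> [] \<Longrightarrow> butlast u \<in> tree r"
  by (cases u rule: rev_cases) (auto simp: tree_snoc)

text \<open>Only ancestors matter, and their labels are strictly shorter. This locality later makes
  the reproduction of generation \<open>n\<close> independent of the tree up to
  \<open>n\<close>.\<close>

lemma special_cong:
  assumes "\<And>v. length v < length u \<Longrightarrow> r v = r' v"
  shows "special r u = special r' u"
  using assms by (induction u rule: rev_induct) (auto simp: special_snoc special.root)

lemma tree_cong:
  assumes "\<And>v. length v < length u \<Longrightarrow> r v = r' v"
  shows "u \<in> tree r \<longleftrightarrow> u \<in> tree r'"
  using assms
proof (induction u rule: rev_induct)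
  case (snoc i u)
  then have "u \<in> tree r \<longleftrightarrow> u \<in> tree r'" "r u = r' u" "special r u = special r' u"
    by (auto intro!: special_cong)
  then show ?case by (simp add: tree_snoc num_children_def)
qed (simp add: tree.root)

section \<open>Moments of the two offspring laws\<close>

context critical_offspring begin

lemma summable_square: "summable (\<lambda>i. real i * real i * pmf \<mu> i)"
proof -
  have int: "integrable (measure_pmf \<mu>) real"
    using mean_one not_integrable_integral_eq by fastforce
  then have "integrable (count_space UNIV) (\<lambda>i. pmf \<mu> i *\<^sub>R real i)"
    unfolding measure_pmf_eq_density by (subst (asm) integrable_density) auto
  then have "summable (\<lambda>i. real i * pmf \<mu> i)"
    by (simp add: integrable_count_space_nat_iff mult.commute)
  from summable_add[OF variance_summable this] show ?thesis
    by (simp add: algebra_simps)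
qed

text \<open>The series is the mean of the size-biased law, that is, the variance plus one. The extra
  1 lets the same constant dominate the mean of \<open>\<mu>\<close> without comparing the
  two.\<close>

definition reproduction_bound :: real where
  "reproduction_bound = 1 + (\<Sum>i. real i * real i * pmf \<mu> i)"

lemma reproduction_bound_ge_one: "1 \<le> reproduction_bound"
  unfolding reproduction_bound_def by (simp add: suminf_nonneg[OF summable_square])

lemma nn_integral_offspring:
  "(\<integral>\<^sup>+i. of_nat i \<partial>measure_pmf \<mu>) = 1"
proof -
  have int: "integrable (measure_pmf \<mu>) real"
    using mean_one not_integrable_integral_eq by fastforce
  have "(\<integral>\<^sup>+i. of_nat i \<partial>measure_pmf \<mu>) = (\<integral>\<^sup>+i. ennreal (real i) \<partial>measure_pmf \<mu>)"
    by (simp add: ennreal_of_nat_eq_real_of_nat)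
  also have "\<dots> = 1"
    using int mean_one by (subst nn_integral_eq_integral) auto
  finally show ?thesis .
qed

lemma map_fst_special_law: "map_pmf fst (special_law \<mu>) = size_biased \<mu>"
  by (simp add: special_law_def map_bind_pmf bind_return_pmf' bind_pmf_const)

lemma nn_integral_special_offspring:
  "(\<integral>\<^sup>+z. of_nat (fst z) \<partial>measure_pmf (special_law \<mu>)) \<le> ennreal reproduction_bound"
proof -
  have "(\<integral>\<^sup>+z. of_nat (fst z) \<partial>measure_pmf (special_law \<mu>)) =
      (\<integral>\<^sup>+i. of_nat i \<partial>measure_pmf (size_biased \<mu>))"
    by (simp flip: map_fst_special_law)
  also have "\<dots> = (\<integral>\<^sup>+i. ennreal (real i * real i * pmf \<mu> i) \<partial>count_space UNIV)"
    unfolding nn_integral_measure_pmf pmf_size_biased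
    by (intro nn_integral_cong)
      (simp add: ennreal_of_nat_eq_real_of_nat ennreal_mult'[symmetric] mult_ac)
  also have "\<dots> = ennreal (\<Sum>i. real i * real i * pmf \<mu> i)"
    by (simp add: nn_integral_count_space_nat suminf_ennreal2 summable_square)
  also have "\<dots> \<le> ennreal reproduction_bound"
    by (intro ennreal_leI) (simp add: reproduction_bound_def)
  finally show ?thesis .
qed

text \<open>The value 0, for which the uniform choice is unspecified, has size-biased mass zero.
  This is what keeps the line of special vertices alive forever.\<close>

lemma special_law_index_less:
  assumes "z \<in> set_pmf (special_law \<mu>)"
  shows "snd z < fst z"
proof -
  from assms obtain k j where kj: "k \<in> set_pmf (size_biased \<mu>)" "j \<in> set_pmf (pmf_of_set {..<k})"
      and z: "z = (k, j)"
    by (auto simp: special_law_def)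
  have "k \<noteq> 0" using kj(1) pmf_size_biased[of 0] by (cases k) (auto simp: set_pmf_iff)
  then have "j < k" using kj(2) by (subst (asm) set_pmf_of_set) auto
  then show ?thesis by (simp add: z)
qed

end

section \<open>The walk given the tree\<close>

text \<open>Tree and positions form one set of pairs, so that its part up to a generation is a
  finite subset of a countable type and takes only countably many values. Positions of labels
  outside the tree are left out, as they are in \<open>history\<close>.\<close>

definition labelled :: "(vertex \<Rightarrow> 'a \<Rightarrow> reproduction) \<Rightarrow> (vertex \<Rightarrow> 'a \<Rightarrow> int) \<Rightarrow> 'a \<Rightarrow> (vertex \<times> int) set" where
  "labelled \<xi> X \<omega> = (\<lambda>u. (u, X u \<omega>)) ` kesten \<xi> \<omega>"

definition prune :: "nat \<Rightarrow> (vertex \<times> int) set \<Rightarrow> (vertex \<times> int) set" where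
  "prune n s = {p \<in> s. length (fst p) \<le> n}"

lemma truncate_enat: "truncate T (enat n) = {u \<in> T. length u \<le> n}"
  by (simp add: truncate_def)

lemma finite_truncate_kesten: "finite (truncate (kesten \<xi> \<omega>) (enat n))"
  unfolding kesten_def by (rule finite_truncate_tree)

lemma prune_labelled: "prune n (labelled \<xi> X \<omega>) = (\<lambda>u. (u, X u \<omega>)) ` truncate (kesten \<xi> \<omega>) (enat n)"
  by (auto simp: prune_def labelled_def truncate_enat)

lemma fst_prune_labelled: "fst ` prune n (labelled \<xi> X \<omega>) = truncate (kesten \<xi> \<omega>) (enat n)"
  by (auto simp: prune_labelled image_image)

lemma finite_prune_labelled: "finite (prune n (labelled \<xi> X \<omega>))"
  by (simp add: prune_labelled finite_truncate_kesten)

lemma prune_prune: "m \<le> n \<Longrightarrow> prune m (prune n s) = prune m s"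
  by (auto simp: prune_def)

lemma butlast_kesten: "u \<in> kesten \<xi> \<omega> \<Longrightarrow> u \<noteq> [] \<Longrightarrow> butlast u \<in> kesten \<xi> \<omega>"
  unfolding kesten_def by (rule butlast_tree)

lemma Nil_kesten: "[] \<in> kesten \<xi> \<omega>"
  unfolding kesten_def by (rule tree.root)

lemma measurable_countable_fibres:
  assumes "countable A" "\<And>\<omega>. \<omega> \<in> space M \<Longrightarrow> f \<omega> \<in> A"
    "\<And>s. s \<in> A \<Longrightarrow> {\<omega> \<in> space M. f \<omega> = s} \<in> sets M"
  shows "f \<in> M \<rightarrow>\<^sub>M count_space A"
  using assms by (subst measurable_count_space_eq_countable) (auto simp: vimage_def Int_def conj_commute)

text \<open>Over a countable type, equality with a fixed set is a countable conjunction of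
  membership events.\<close>

lemma pred_set_eq:
  fixes f :: "'a \<Rightarrow> 'b::countable set"
  assumes [measurable]: "\<And>x. Measurable.pred M (\<lambda>\<omega>. x \<in> f \<omega>)"
  shows "{\<omega> \<in> space M. f \<omega> = s} \<in> sets M"
  unfolding set_eq_iff by measurable

context vrbrw begin

lemma space_history [simp]: "space (history M \<xi> X n) = space M"
  by (simp add: history_def space_measure_of_conv)

lemma sets_history_subset: "A \<in> sets (history M \<xi> X n) \<Longrightarrow> A \<in> sets M"
  using subalgebra_history[of n] by (auto simp: subalgebra_def)

lemma history_kesten [measurable]: "Measurable.pred (history M \<xi> X n) (\<lambda>\<omega>. u \<in> kesten \<xi> \<omega>)"
  unfolding pred_def space_history unfolding history_def
  by (subst sets_measure_of) auto

lemma history_position: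
  "Measurable.pred (history M \<xi> X n) (\<lambda>\<omega>. u \<in> truncate (kesten \<xi> \<omega>) (enat n) \<and> X u \<omega> = x)"
  unfolding pred_def space_history unfolding history_def
  by (subst sets_measure_of) (auto intro!: sigma_sets.Basic intro: rev_image_eqI[where x = "(u, x)"])

text \<open>There is no relation between \<open>k\<close> and \<open>n\<close>, because every
  history knows the entire tree, including its future.\<close>

lemma history_truncate:
  "{\<omega> \<in> space M. truncate (kesten \<xi> \<omega>) (enat k) = t} \<in> sets (history M \<xi> X n)"
  using pred_set_eq[where M = "history M \<xi> X n" and f = "\<lambda>\<omega>. truncate (kesten \<xi> \<omega>) (enat k)" and s = t]
  by (simp add: truncate_enat)

lemma history_prune:
  assumes "k \<le> n"
  shows "{\<omega> \<in> space M. prune k (labelled \<xi> X \<omega>) = s} \<in> sets (history M \<xi> X n)"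
proof -
  have "Measurable.pred (history M \<xi> X n) (\<lambda>\<omega>. (u, x) \<in> prune k (labelled \<xi> X \<omega>))" for u x
  proof -
    have "(u, x) \<in> prune k (labelled \<xi> X \<omega>) \<longleftrightarrow>
        length u \<le> k \<and> u \<in> truncate (kesten \<xi> \<omega>) (enat n) \<and> X u \<omega> = x" for \<omega>
      using assms by (auto simp: prune_labelled truncate_enat)
    then show ?thesis using history_position[of u n x] by simp
  qed
  then show ?thesis
    using pred_set_eq[where M = "history M \<xi> X n" and f = "\<lambda>\<omega>. prune k (labelled \<xi> X \<omega>)" and s = s] by auto
qed

lemma prune_0:
  assumes "\<omega> \<in> space M"
  shows "prune 0 (labelled \<xi> X \<omega>) = {([], 0)}"
  using assms by (auto simp: prune_labelled truncate_enat Nil_kesten position_root)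

lemmas sets_prune = sets_history_subset[OF history_prune, OF order_refl]
lemmas sets_truncate = sets_history_subset[OF history_truncate]

lemma measurable_prune [measurable]:
  "(\<lambda>\<omega>. prune n (labelled \<xi> X \<omega>)) \<in> M \<rightarrow>\<^sub>M count_space (Collect finite)"
  by (intro measurable_countable_fibres countable_Collect_finite sets_prune)
    (simp_all add: finite_prune_labelled)

lemma measurable_truncate:
  "(\<lambda>\<omega>. truncate (kesten \<xi> \<omega>) (enat n)) \<in> M \<rightarrow>\<^sub>M count_space (Collect finite)"
  by (intro measurable_countable_fibres countable_Collect_finite sets_truncate)
    (simp_all add: finite_truncate_kesten)

text \<open>The almost sure identity in \<open>transition\<close> is integrated over an event of the
  history on which its right-hand side is constant. All later arguments use this unconditional
  form.\<close>

lemma prob_next_positions: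
  assumes D: "D \<in> sets (history M \<xi> X n)" and V: "finite V" "\<And>v. v \<in> V \<Longrightarrow> length v = Suc n"
    and sub: "\<And>\<omega>. \<omega> \<in> D \<Longrightarrow> V \<subseteq> kesten \<xi> \<omega>"
    and r: "\<And>\<omega>. \<omega> \<in> D \<Longrightarrow>
      (\<Prod>v\<in>V. step_prob w (kesten \<xi> \<omega>) (\<lambda>u. X u \<omega>) n (X (butlast v) \<omega>) (y v)) = r"
  shows "prob (D \<inter> {\<omega> \<in> space M. \<forall>v\<in>V. X v \<omega> = y v}) = r * prob D"
proof -
  let ?F = "history M \<xi> X n" and ?A = "{\<omega> \<in> space M. \<forall>v\<in>V. X v \<omega> = y v}"
  have "finite_measure_subalgebra M ?F"
    by unfold_locales (rule subalgebra_history)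
  then interpret F: sigma_finite_subalgebra M ?F
    by (rule finite_measure_subalgebra_is_sigma_finite)
  note [measurable] = measurable_position
  have [measurable]: "?A \<in> sets M"
    using V(1) by measurable
  have [measurable]: "D \<in> sets M" by (rule sets_history_subset[OF D])
  have tr: "AE \<omega> in M. V \<subseteq> kesten \<xi> \<omega> \<longrightarrow> real_cond_exp M ?F (indicator ?A) \<omega> =
      (\<Prod>v\<in>V. step_prob w (kesten \<xi> \<omega>) (\<lambda>u. X u \<omega>) n (X (butlast v) \<omega>) (y v))"
    using transition[of V n y] V by blast
  have "prob (D \<inter> ?A) = (\<integral>\<omega>\<in>D. indicator ?A \<omega> \<partial>M)"
    by (simp add: set_lebesgue_integral_def indicator_inter_arith[symmetric])
  also have "\<dots> = (\<integral>\<omega>\<in>D. real_cond_exp M ?F (indicator ?A) \<omega> \<partial>M)"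
    by (intro F.real_cond_exp_intA D integrable_const_bound[where B = 1]) auto
  also have "\<dots> = (\<integral>\<omega>\<in>D. r \<partial>M)"
    unfolding set_lebesgue_integral_def
  proof (rule integral_cong_AE)
    show "AE \<omega> in M. indicator D \<omega> *\<^sub>R real_cond_exp M ?F (indicator ?A) \<omega> = indicator D \<omega> *\<^sub>R r"
      using tr by eventually_elim (auto simp: r sub indicator_def)
  qed auto
  also have "\<dots> = r * prob D" by (simp add: set_lebesgue_integral_def)
  finally show ?thesis .
qed

end

section \<open>The one-step law as a function of the finite state\<close>

definition visits :: "(vertex \<times> int) set \<Rightarrow> nat \<Rightarrow> int \<Rightarrow> nat" where
  "visits s n y = card {u. (u, y) \<in> s \<and> length u \<le> n}"

definition jump :: "(nat \<Rightarrow> real) \<Rightarrow> (vertex \<times> int) set \<Rightarrow> nat \<Rightarrow> int \<Rightarrow> int \<Rightarrow> real" where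
  "jump w s n x y = (if y = x - 1 \<or> y = x + 1
     then w (visits s n y) / (w (visits s n (x - 1)) + w (visits s n (x + 1))) else 0)"

text \<open>The description is unambiguous on the states that occur, since these are graphs of
  functions of the label.\<close>

definition pos :: "(vertex \<times> int) set \<Rightarrow> vertex \<Rightarrow> int" where
  "pos s u = (THE x. (u, x) \<in> s)"

lemma visits_prune: "n \<le> k \<Longrightarrow> visits (prune k s) n y = visits s n y"
  unfolding visits_def by (rule arg_cong[where f = card]) (auto simp: prune_def)

lemma jump_prune: "n \<le> k \<Longrightarrow> jump w (prune k s) n x y = jump w s n x y"
  by (simp add: jump_def visits_prune)

lemma visits_labelled: "visits (labelled \<xi> X \<omega>) n y = the_enat (local_time (kesten \<xi> \<omega>) (\<lambda>u. X u \<omega>) (enat n) y)"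
proof -
  have "{u \<in> truncate (kesten \<xi> \<omega>) (enat n). X u \<omega> = y} = {u. (u, y) \<in> labelled \<xi> X \<omega> \<and> length u \<le> n}"
    by (auto simp: labelled_def truncate_enat)
  then show ?thesis
    using finite_truncate_kesten[of \<xi> \<omega> n]
    by (simp add: local_time_def visits_def Let_def)
       (metis (no_types, lifting) finite_subset mem_Collect_eq subsetI the_enat.simps)
qed

lemma step_prob_labelled:
  "step_prob w (kesten \<xi> \<omega>) (\<lambda>u. X u \<omega>) n x y = jump w (labelled \<xi> X \<omega>) n x y"
  by (simp add: step_prob_def jump_def visits_labelled Let_def)

lemma pos_prune_labelled:
  "u \<in> truncate (kesten \<xi> \<omega>) (enat n) \<Longrightarrow> pos (prune n (labelled \<xi> X \<omega>)) u = X u \<omega>"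
  unfolding pos_def by (rule the_equality) (auto simp: prune_labelled)

lemma butlast_truncate_kesten:
  "v \<in> kesten \<xi> \<omega> \<Longrightarrow> length v = Suc n \<Longrightarrow> butlast v \<in> truncate (kesten \<xi> \<omega>) (enat n)"
  by (auto simp: truncate_enat intro: butlast_kesten)

context vrbrw begin

abbreviation states :: "nat \<Rightarrow> (vertex \<times> int) set \<Rightarrow> 'a set" where
  "states n s \<equiv> {\<omega> \<in> space M. prune n (labelled \<xi> X \<omega>) = s}"

abbreviation trees :: "nat \<Rightarrow> vertex set \<Rightarrow> 'a set" where
  "trees n t \<equiv> {\<omega> \<in> space M. truncate (kesten \<xi> \<omega>) (enat n) = t}"

text \<open>On a fibre of \<open>prune n\<close>, local times and parents' positions are fixed, so
  the transition product is a constant depending on \<open>s\<close> alone. A sample point of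
  \<open>D\<close> supplies the finiteness of \<open>V\<close>; this is why the empty event is
  treated apart.\<close>

lemma prob_next_state:
  assumes D: "D \<in> sets (history M \<xi> X n)" and V: "\<And>v. v \<in> V \<Longrightarrow> length v = Suc n"
    and sub: "\<And>\<omega>. \<omega> \<in> D \<Longrightarrow> V \<subseteq> kesten \<xi> \<omega>" and s: "D \<subseteq> states n s"
  shows "prob (D \<inter> {\<omega> \<in> space M. \<forall>v\<in>V. X v \<omega> = y v}) =
    (\<Prod>v\<in>V. jump w s n (pos s (butlast v)) (y v)) * prob D"
proof (cases "D = {}")
  case False
  then obtain \<omega>0 where "\<omega>0 \<in> D" by auto
  then have "V \<subseteq> truncate (kesten \<xi> \<omega>0) (enat (Suc n))"
    using sub V by (auto simp: truncate_enat)
  then have "finite V" by (rule finite_subset) (rule finite_truncate_kesten)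
  then show ?thesis
  proof (rule prob_next_positions[OF D _ V sub])
    fix \<omega> assume \<omega>: "\<omega> \<in> D"
    then have seq: "s = prune n (labelled \<xi> X \<omega>)" using s by auto
    show "(\<Prod>v\<in>V. step_prob w (kesten \<xi> \<omega>) (\<lambda>u. X u \<omega>) n (X (butlast v) \<omega>) (y v)) =
        (\<Prod>v\<in>V. jump w s n (pos s (butlast v)) (y v))"
    proof (rule prod.cong)
      fix v assume v: "v \<in> V"
      then have "v \<in> kesten \<xi> \<omega>" using sub[OF \<omega>] by auto
      then show "step_prob w (kesten \<xi> \<omega>) (\<lambda>u. X u \<omega>) n (X (butlast v) \<omega>) (y v) =
          jump w s n (pos s (butlast v)) (y v)"
        unfolding seq step_prob_labelled
        by (simp add: jump_prune pos_prune_labelled butlast_truncate_kesten V[OF v])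
    qed simp
  qed auto
qed simp

lemma prob_next_positions_in:
  fixes Y :: "vertex \<Rightarrow> int set"
  assumes V: "V = {v \<in> t. length v = Suc n}" and Y: "\<And>v. v \<in> V \<Longrightarrow> finite (Y v)"
  shows "prob (states n s \<inter> trees (Suc n) t \<inter> {\<omega> \<in> space M. \<forall>v\<in>V. X v \<omega> \<in> Y v}) =
    (\<Prod>v\<in>V. \<Sum>y\<in>Y v. jump w s n (pos s (butlast v)) y) * prob (states n s \<inter> trees (Suc n) t)"
proof (cases "states n s \<inter> trees (Suc n) t = {}")
  case True
  then show ?thesis by simp
next
  case False
  let ?D = "states n s \<inter> trees (Suc n) t"
  note [measurable] = measurable_position
  from False obtain \<omega>0 where "truncate (kesten \<xi> \<omega>0) (enat (Suc n)) = t" by auto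
  then have "finite t" using finite_truncate_kesten by metis
  then have finV: "finite V" by (simp add: V)
  have Vt: "V \<subseteq> kesten \<xi> \<omega>" if "\<omega> \<in> ?D" for \<omega>
    using that by (auto simp: V truncate_enat)
  have D: "?D \<in> sets (history M \<xi> X n)"
    by (intro sets.Int history_prune history_truncate order_refl)
  have [measurable]: "{\<omega> \<in> space M. \<forall>v\<in>V. X v \<omega> = y v} \<in> sets M" for y
    using finV by measurable
  \<comment> \<open>Extensional functions are used so that distinct choices of \<open>y\<close> give
    disjoint events; the sum over them then factorises into a product of sums.\<close>
  have "?D \<inter> {\<omega> \<in> space M. \<forall>v\<in>V. X v \<omega> \<in> Y v} =
      (\<Union>y\<in>PiE V Y. ?D \<inter> {\<omega> \<in> space M. \<forall>v\<in>V. X v \<omega> = y v})"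
  proof (intro equalityI subsetI)
    fix \<omega> assume "\<omega> \<in> ?D \<inter> {\<omega> \<in> space M. \<forall>v\<in>V. X v \<omega> \<in> Y v}"
    then show "\<omega> \<in> (\<Union>y\<in>PiE V Y. ?D \<inter> {\<omega> \<in> space M. \<forall>v\<in>V. X v \<omega> = y v})"
      by (intro UN_I[of "restrict (\<lambda>v. X v \<omega>) V"]) auto
  qed (auto simp: PiE_iff)
  also have "prob \<dots> = (\<Sum>y\<in>PiE V Y. prob (?D \<inter> {\<omega> \<in> space M. \<forall>v\<in>V. X v \<omega> = y v}))"
  proof (rule finite_measure_finite_Union)
    show "finite (PiE V Y)" using finV Y by (rule finite_PiE)
    show "(\<lambda>y. ?D \<inter> {\<omega> \<in> space M. \<forall>v\<in>V. X v \<omega> = y v}) ` PiE V Y \<subseteq> sets M"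
      using sets_history_subset[OF D] by auto
    show "disjoint_family_on (\<lambda>y. ?D \<inter> {\<omega> \<in> space M. \<forall>v\<in>V. X v \<omega> = y v}) (PiE V Y)"
      unfolding disjoint_family_on_def by (auto intro: PiE_ext)
  qed
  also have "\<dots> = (\<Sum>y\<in>PiE V Y. (\<Prod>v\<in>V. jump w s n (pos s (butlast v)) (y v)) * prob ?D)"
    by (intro sum.cong prob_next_state D Vt) (auto simp: V)
  also have "\<dots> = (\<Prod>v\<in>V. \<Sum>y\<in>Y v. jump w s n (pos s (butlast v)) y) * prob ?D"
    by (simp add: prod_sum_PiE[OF finV Y] sum_distrib_right)
  finally show ?thesis .
qed

text \<open>The events that lie in all the histories include those determined by the tree alone.\<close>

lemma positions_given_tree:
  "\<exists>c\<ge>0. \<forall>D. (\<forall>k. D \<in> sets (history M \<xi> X k)) \<longrightarrow>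
    prob (states n s \<inter> D) = c * prob (trees n (fst ` s) \<inter> D)"
proof (induction n arbitrary: s)
  case 0
  have tr: "truncate (kesten \<xi> \<omega>) (enat 0) = {[]}" for \<omega>
    by (auto simp: truncate_enat Nil_kesten)
  show ?case
  proof (cases "s = {([], 0)}")
    case True
    then have "states 0 s = space M" "trees 0 (fst ` s) = space M" using prune_0 tr by auto
    then show ?thesis by (intro exI[of _ 1]) auto
  next
    case False
    then have "states 0 s \<inter> D = {}" for D using prune_0 by auto
    then show ?thesis by (intro exI[of _ 0]) (simp only: measure_empty, simp)
  qed
next
  case (Suc n)
  show ?case
  proof (cases "states (Suc n) s = {}")
    case True
    then have "states (Suc n) s \<inter> D = {}" for D by auto
    then show ?thesis by (intro exI[of _ 0]) (simp only: measure_empty, simp)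
  next
    case False
    then obtain \<omega>0 where s0: "s = prune (Suc n) (labelled \<xi> X \<omega>0)" by auto
    let ?t = "fst ` s" and ?V = "{v \<in> fst ` s. length v = Suc n}"
    have t: "?t = truncate (kesten \<xi> \<omega>0) (enat (Suc n))"
      by (simp add: s0 fst_prune_labelled)
    have eq: "states (Suc n) s =
        states n (prune n s) \<inter> trees (Suc n) ?t \<inter> {\<omega> \<in> space M. \<forall>v\<in>?V. X v \<omega> = X v \<omega>0}"
      (is "_ = ?R")
    proof (intro equalityI subsetI)
      fix \<omega> assume "\<omega> \<in> states (Suc n) s"
      then have \<omega>: "\<omega> \<in> space M" and s: "s = prune (Suc n) (labelled \<xi> X \<omega>)" by auto
      have "X v \<omega> = X v \<omega>0" if "v \<in> truncate (kesten \<xi> \<omega>0) (enat (Suc n))" for v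
      proof -
        have "(v, X v \<omega>0) \<in> prune (Suc n) (labelled \<xi> X \<omega>)"
          using that by (simp flip: s) (simp add: s0 prune_labelled)
        then show ?thesis by (auto simp: prune_labelled)
      qed
      moreover have "prune n s = prune n (labelled \<xi> X \<omega>)" by (simp add: s prune_prune)
      moreover have "truncate (kesten \<xi> \<omega>) (enat (Suc n)) = ?t" by (simp add: s fst_prune_labelled)
      ultimately show "\<omega> \<in> ?R" using \<omega> t by auto
    next
      fix \<omega> assume "\<omega> \<in> ?R"
      then have \<omega>: "\<omega> \<in> space M" and sn: "prune n (labelled \<xi> X \<omega>) = prune n s"
        and tr: "truncate (kesten \<xi> \<omega>) (enat (Suc n)) = ?t" and X: "\<forall>v\<in>?V. X v \<omega> = X v \<omega>0" by auto
      have "X u \<omega> = X u \<omega>0" if u: "u \<in> ?t" for u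
      proof (cases "length u = Suc n")
        case True
        then show ?thesis using X u by auto
      next
        case False
        then have "u \<in> truncate (kesten \<xi> \<omega>0) (enat n)" using u by (auto simp: t truncate_enat)
        then have "(u, X u \<omega>0) \<in> prune n (labelled \<xi> X \<omega>)"
          by (simp add: sn s0 prune_prune) (simp add: prune_labelled)
        then show ?thesis by (auto simp: prune_labelled)
      qed
      then have "prune (Suc n) (labelled \<xi> X \<omega>) = s"
        unfolding prune_labelled tr s0 using t by (auto simp: prune_labelled s0)
      then show "\<omega> \<in> states (Suc n) s" using \<omega> by auto
    qed
    from Suc.IH[of "prune n s"] obtain c where c: "c \<ge> 0"
      and IH: "\<And>D. (\<forall>k. D \<in> sets (history M \<xi> X k)) \<Longrightarrow>
        prob (states n (prune n s) \<inter> D) = c * prob (trees n (fst ` prune n s) \<inter> D)" by blast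
    define r where "r = (\<Prod>v\<in>?V. jump w (prune n s) n (pos (prune n s) (butlast v)) (X v \<omega>0))"
    have "r \<ge> 0" unfolding r_def
      by (intro prod_nonneg) (auto simp: jump_def intro!: divide_nonneg_nonneg add_nonneg_nonneg less_imp_le[OF weight_pos])
    moreover have "prob (states (Suc n) s \<inter> D) = r * c * prob (trees (Suc n) ?t \<inter> D)"
      if D: "\<forall>k. D \<in> sets (history M \<xi> X k)" for D
    proof -
      have "prob (states (Suc n) s \<inter> D) = prob (states n (prune n s) \<inter> (trees (Suc n) ?t \<inter> D)
          \<inter> {\<omega> \<in> space M. \<forall>v\<in>?V. X v \<omega> = X v \<omega>0})"
        unfolding eq by (simp add: Int_ac)
      also have "\<dots> = r * prob (states n (prune n s) \<inter> (trees (Suc n) ?t \<inter> D))"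
        unfolding r_def
      proof (rule prob_next_state)
        show "states n (prune n s) \<inter> (trees (Suc n) ?t \<inter> D) \<in> sets (history M \<xi> X n)"
          using D by (intro sets.Int history_prune history_truncate order_refl) auto
      qed (auto simp: truncate_enat)
      \<comment> \<open>The induction hypothesis is applied to \<open>D\<close> cut down by the
        shape of generation \<open>n + 1\<close>. This is admissible because that shape lies in
        every history, and it is the reason for stating the claim for all such
        \<open>D\<close>.\<close>
      also have "\<dots> = r * c * prob (trees n (fst ` prune n s) \<inter> (trees (Suc n) ?t \<inter> D))"
        using D by (subst IH) (auto intro!: sets.Int history_truncate)
      also have "trees n (fst ` prune n s) \<inter> (trees (Suc n) ?t \<inter> D) = trees (Suc n) ?t \<inter> D"
      proof -
        have "fst ` prune n s = {u \<in> ?t. length u \<le> n}"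
          by (auto simp: prune_def intro: rev_image_eqI)
        then show ?thesis by (auto simp: truncate_enat)
      qed
      finally show ?thesis .
    qed
    ultimately show ?thesis using c by (intro exI[of _ "r * c"]) auto
  qed
qed

end

section \<open>Independence of the offspring numbers from the past\<close>

lemma pred_special_PiM:
  assumes "length u \<le> n"
  shows "Measurable.pred (PiM {v. length v < n} (\<lambda>_. count_space UNIV)) (\<lambda>r. special r u)"
  using assms
proof (induction u rule: rev_induct)
  case Nil
  then show ?case by (simp add: special.root)
next
  case (snoc i u)
  have [measurable]: "Measurable.pred (PiM {v. length v < n} (\<lambda>_. count_space UNIV)) (\<lambda>r. i = snd (snd (r u)))"
    using snoc(2) by (intro measurable_compose[OF measurable_component_singleton]) auto
  have [measurable]: "Measurable.pred (PiM {v. length v < n} (\<lambda>_. count_space UNIV)) (\<lambda>r. special r u)"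
    using snoc by simp
  show ?case unfolding special_snoc by measurable
qed

lemma pred_tree_PiM:
  assumes "length u \<le> n"
  shows "Measurable.pred (PiM {v. length v < n} (\<lambda>_. count_space UNIV)) (\<lambda>r. u \<in> tree r)"
  using assms
proof (induction u rule: rev_induct)
  case Nil
  then show ?case by (simp add: tree.root)
next
  case (snoc i u)
  have [measurable]: "Measurable.pred (PiM {v. length v < n} (\<lambda>_. count_space UNIV)) (\<lambda>r. P (r u))" for P
    using snoc(2) by (intro measurable_compose[OF measurable_component_singleton]) auto
  have [measurable]: "Measurable.pred (PiM {v. length v < n} (\<lambda>_. count_space UNIV)) (\<lambda>r. special r u)"
    using snoc by (intro pred_special_PiM) simp
  have [measurable]: "Measurable.pred (PiM {v. length v < n} (\<lambda>_. count_space UNIV)) (\<lambda>r. u \<in> tree r)"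
    using snoc by simp
  have "i < num_children r u \<longleftrightarrow>
      (special r u \<and> i < fst (snd (r u))) \<or> (\<not> special r u \<and> i < fst (r u))" for r
    by (simp add: num_children_def case_prod_beta)
  then show ?case unfolding tree_snoc by simp
qed

context kesten_tree begin

lemma nn_integral_reproduction:
  "(\<integral>\<^sup>+\<omega>. f (\<xi> u \<omega>) \<partial>M) = (\<integral>\<^sup>+z. f z \<partial>measure_pmf (pair_pmf \<mu> (special_law \<mu>)))"
  unfolding distr_reproduction[of u, symmetric]
  by (subst nn_integral_distr) auto

text \<open>Labels of length below \<open>n\<close> and the label \<open>u\<close> are disjoint sets
  of indices. The layer formula for integrals of natural-valued functions reduces the product rule
  for the integral to the one for the events \<open>t < f (\<xi> u \<omega>)\<close>.\<close>

lemma nn_integral_reproduction_past: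
  fixes f :: "reproduction \<Rightarrow> nat"
  assumes P: "Measurable.pred (PiM {v. length v < n} (\<lambda>_. count_space UNIV)) P" and u: "n \<le> length u"
    and B: "B = {\<omega> \<in> space M. P (restrict (\<lambda>v. \<xi> v \<omega>) {v. length v < n})}"
  shows "(\<integral>\<^sup>+\<omega>. of_nat (f (\<xi> u \<omega>)) * indicator B \<omega> \<partial>M) = (\<integral>\<^sup>+\<omega>. of_nat (f (\<xi> u \<omega>)) \<partial>M) * emeasure M B"
    and "B \<in> sets M"
proof -
  let ?A = "{v :: vertex. length v < n}"
  let ?N = "\<lambda>I. PiM I (\<lambda>_ :: vertex. count_space (UNIV :: reproduction set))"
  have ind: "indep_var (?N ?A) (\<lambda>\<omega>. restrict (\<lambda>v. \<xi> v \<omega>) ?A) (?N {u}) (\<lambda>\<omega>. restrict (\<lambda>v. \<xi> v \<omega>) {u})"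
    using u by (intro indep_var_restrict[OF indep_reproduction]) auto
  have PA: "{r \<in> space (?N ?A). P r} \<in> sets (?N ?A)" using P by (simp add: pred_def)
  have Kt: "{r \<in> space (?N {u}). t < f (r u)} \<in> sets (?N {u})" for t
  proof -
    have "Measurable.pred (?N {u}) (\<lambda>r. t < f (r u))"
      by (rule measurable_compose[OF measurable_component_singleton]) auto
    then show ?thesis by (simp add: pred_def)
  qed
  have resA: "(\<lambda>\<omega>. restrict (\<lambda>v. \<xi> v \<omega>) ?A) \<in> M \<rightarrow>\<^sub>M ?N ?A"
    by (rule indep_var_rv1[OF ind])
  have Beq: "(\<lambda>\<omega>. restrict (\<lambda>v. \<xi> v \<omega>) ?A) -` {r \<in> space (?N ?A). P r} \<inter> space M = B"
    using measurable_space[OF resA] by (auto simp: B)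
  show BM [measurable]: "B \<in> sets M"
    using measurable_sets[OF resA PA] by (simp only: Beq)
  have prod: "emeasure M (B \<inter> {\<omega> \<in> space M. t < f (\<xi> u \<omega>)}) =
      emeasure M {\<omega> \<in> space M. t < f (\<xi> u \<omega>)} * emeasure M B" for t
  proof -
    have Keq: "(\<lambda>\<omega>. restrict (\<lambda>v. \<xi> v \<omega>) {u}) -` {r \<in> space (?N {u}). t < f (r u)} \<inter> space M =
        {\<omega> \<in> space M. t < f (\<xi> u \<omega>)}"
      by (auto simp: space_PiM)
    have "prob ((\<lambda>\<omega>. (restrict (\<lambda>v. \<xi> v \<omega>) ?A, restrict (\<lambda>v. \<xi> v \<omega>) {u})) -`
        ({r \<in> space (?N ?A). P r} \<times> {r \<in> space (?N {u}). t < f (r u)}) \<inter> space M) =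
        prob B * prob {\<omega> \<in> space M. t < f (\<xi> u \<omega>)}"
      using indep_varD[OF ind PA Kt[of t]] unfolding Beq Keq .
    also have "(\<lambda>\<omega>. (restrict (\<lambda>v. \<xi> v \<omega>) ?A, restrict (\<lambda>v. \<xi> v \<omega>) {u})) -`
        ({r \<in> space (?N ?A). P r} \<times> {r \<in> space (?N {u}). t < f (r u)}) \<inter> space M =
        B \<inter> {\<omega> \<in> space M. t < f (\<xi> u \<omega>)}"
      unfolding Beq[symmetric] Keq[symmetric] by auto
    finally show ?thesis by (simp add: emeasure_eq_measure ennreal_mult[symmetric] mult.commute)
  qed
  have [measurable]: "(\<lambda>\<omega>. f (\<xi> u \<omega>)) \<in> M \<rightarrow>\<^sub>M count_space UNIV"
    by (rule measurable_compose[OF measurable_reproduction]) simp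
  have "(\<integral>\<^sup>+\<omega>. of_nat (f (\<xi> u \<omega>)) * indicator B \<omega> \<partial>M) =
      (\<integral>\<^sup>+\<omega>. of_nat (if \<omega> \<in> B then f (\<xi> u \<omega>) else 0) \<partial>M)"
    by (intro nn_integral_cong) (auto simp: indicator_def)
  also have "\<dots> = (\<Sum>t. emeasure M {\<omega> \<in> space M. t < (if \<omega> \<in> B then f (\<xi> u \<omega>) else 0)})"
    by (rule nn_integral_nat_function) measurable
  also have "\<dots> = (\<Sum>t. emeasure M {\<omega> \<in> space M. t < f (\<xi> u \<omega>)} * emeasure M B)"
    unfolding prod[symmetric]
    by (intro suminf_cong arg_cong[where f = "emeasure M"]) (auto simp: B split: if_splits)
  also have "\<dots> = (\<integral>\<^sup>+\<omega>. of_nat (f (\<xi> u \<omega>)) \<partial>M) * emeasure M B"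
    by (subst nn_integral_nat_function) simp_all
  finally show "(\<integral>\<^sup>+\<omega>. of_nat (f (\<xi> u \<omega>)) * indicator B \<omega> \<partial>M) =
    (\<integral>\<^sup>+\<omega>. of_nat (f (\<xi> u \<omega>)) \<partial>M) * emeasure M B" .
qed

text \<open>Whether \<open>u\<close> is special is decided by shorter labels. The event is therefore
  split by this status, and on either half the number of children is one coordinate of an
  independent triple with mean at most \<open>reproduction_bound\<close>.\<close>

lemma nn_integral_num_children:
  assumes u: "length u = n"
  shows "(\<integral>\<^sup>+\<omega>. of_nat (num_children (\<lambda>u. \<xi> u \<omega>) u) *
      indicator {\<omega> \<in> space M. truncate (kesten \<xi> \<omega>) (enat n) = t} \<omega> \<partial>M)
    \<le> ennreal reproduction_bound * emeasure M {\<omega> \<in> space M. truncate (kesten \<xi> \<omega>) (enat n) = t}"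
proof -
  let ?N = "PiM {v. length v < n} (\<lambda>_ :: vertex. count_space (UNIV :: reproduction set))"
  let ?r = "\<lambda>\<omega>. restrict (\<lambda>v. \<xi> v \<omega>) {v. length v < n}"
  let ?T = "\<lambda>r. truncate (tree r) (enat n) = t"
  define B where "B c = {\<omega> \<in> space M. ?T (?r \<omega>) \<and> special (?r \<omega>) u = c}" for c
  have loc: "truncate (tree (?r \<omega>)) (enat n) = truncate (kesten \<xi> \<omega>) (enat n)"
    "special (?r \<omega>) u = special (\<lambda>u. \<xi> u \<omega>) u" for \<omega>
    unfolding truncate_enat kesten_def using u
    by (auto intro!: special_cong intro: tree_cong[THEN iffD1, rotated])
  have [measurable]: "Measurable.pred ?N (\<lambda>r. special r u)"
    using u by (intro pred_special_PiM) simp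
  have [measurable]: "Measurable.pred ?N ?T"
  proof -
    have "Measurable.pred ?N (\<lambda>r. v \<in> truncate (tree r) (enat n))" for v
      by (cases "length v \<le> n") (simp_all add: truncate_enat pred_tree_PiM)
    from pred_set_eq[OF this, of t] show ?thesis by (simp add: pred_def)
  qed
  have P: "Measurable.pred ?N (\<lambda>r. ?T r \<and> special r u = c)" for c by measurable
  have past: "(\<integral>\<^sup>+\<omega>. of_nat (f (\<xi> u \<omega>)) * indicator (B c) \<omega> \<partial>M) =
      (\<integral>\<^sup>+\<omega>. of_nat (f (\<xi> u \<omega>)) \<partial>M) * emeasure M (B c)" "B c \<in> sets M" for f c
    using nn_integral_reproduction_past(1)[OF P[of c], where u = u and B = "B c" and f = f]
      nn_integral_reproduction_past(2)[OF P[of c], where u = u and B = "B c"] by (simp_all add: B_def u)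
  have [measurable]: "B c \<in> sets M" for c by (rule past(2))
  have [measurable]: "(\<lambda>\<omega>. f (\<xi> u \<omega>)) \<in> borel_measurable M" for f :: "_ \<Rightarrow> ennreal"
    by (rule measurable_compose[OF measurable_reproduction]) simp
  have eq: "{\<omega> \<in> space M. truncate (kesten \<xi> \<omega>) (enat n) = t} = B True \<union> B False"
    by (auto simp: B_def loc)
  have k1: "(\<integral>\<^sup>+\<omega>. of_nat (fst (\<xi> u \<omega>)) \<partial>M) \<le> ennreal reproduction_bound"
  proof -
    have "(\<integral>\<^sup>+\<omega>. of_nat (fst (\<xi> u \<omega>)) \<partial>M) = (\<integral>\<^sup>+i. of_nat i \<partial>measure_pmf (map_pmf fst (pair_pmf \<mu> (special_law \<mu>))))"
      by (subst nn_integral_reproduction) simp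
    also have "\<dots> = ennreal 1" by (simp add: map_fst_pair_pmf nn_integral_offspring)
    also have "\<dots> \<le> ennreal reproduction_bound" by (intro ennreal_leI reproduction_bound_ge_one)
    finally show ?thesis .
  qed
  have k2: "(\<integral>\<^sup>+\<omega>. of_nat (fst (snd (\<xi> u \<omega>))) \<partial>M) \<le> ennreal reproduction_bound"
  proof -
    have "(\<integral>\<^sup>+\<omega>. of_nat (fst (snd (\<xi> u \<omega>))) \<partial>M) =
        (\<integral>\<^sup>+z. of_nat (fst z) \<partial>measure_pmf (map_pmf snd (pair_pmf \<mu> (special_law \<mu>))))"
      by (subst nn_integral_reproduction) simp
    then show ?thesis by (simp add: map_snd_pair_pmf nn_integral_special_offspring)
  qed
  have "(\<integral>\<^sup>+\<omega>. of_nat (num_children (\<lambda>u. \<xi> u \<omega>) u) *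
      indicator {\<omega> \<in> space M. truncate (kesten \<xi> \<omega>) (enat n) = t} \<omega> \<partial>M) =
      (\<integral>\<^sup>+\<omega>. of_nat (fst (snd (\<xi> u \<omega>))) * indicator (B True) \<omega> +
        of_nat (fst (\<xi> u \<omega>)) * indicator (B False) \<omega> \<partial>M)"
    by (intro nn_integral_cong)
      (auto simp: indicator_def B_def loc num_children_def case_prod_beta)
  also have "\<dots> = (\<integral>\<^sup>+\<omega>. of_nat (fst (snd (\<xi> u \<omega>))) * indicator (B True) \<omega> \<partial>M) +
      (\<integral>\<^sup>+\<omega>. of_nat (fst (\<xi> u \<omega>)) * indicator (B False) \<omega> \<partial>M)"
    by (rule nn_integral_add) auto
  also have "\<dots> = (\<integral>\<^sup>+\<omega>. of_nat (fst (snd (\<xi> u \<omega>))) \<partial>M) * emeasure M (B True) +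
      (\<integral>\<^sup>+\<omega>. of_nat (fst (\<xi> u \<omega>)) \<partial>M) * emeasure M (B False)"
    using past(1)[of "\<lambda>z. fst (snd z)" True] past(1)[of fst False] by simp
  also have "\<dots> \<le> ennreal reproduction_bound * emeasure M (B True) +
      ennreal reproduction_bound * emeasure M (B False)"
    by (intro add_mono mult_right_mono k1 k2) auto
  also have "\<dots> = ennreal reproduction_bound * emeasure M (B True \<union> B False)"
    by (subst plus_emeasure[symmetric]) (auto simp: B_def distrib_left)
  finally show ?thesis unfolding eq .
qed

end

context vrbrw begin

text \<open>This transfers the mean bound from tree shapes to states with positions. For
  \<open>u\<close> in the tree, having more than \<open>t\<close> children means that
  \<open>u @ [t]\<close> is in the tree, an event of all histories. By
  \<open>positions_given_tree\<close>, passing from the shape to the state multiplies every layer,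
  and also the total mass, by the same factor \<open>c\<close>.\<close>

lemma nn_integral_num_children_state:
  assumes u: "length u = n" "u \<in> fst ` s"
  shows "(\<integral>\<^sup>+\<omega>. of_nat (num_children (\<lambda>u. \<xi> u \<omega>) u) * indicator (states n s) \<omega> \<partial>M)
    \<le> ennreal reproduction_bound * emeasure M (states n s)"
proof -
  let ?K = "\<lambda>\<omega>. num_children (\<lambda>u. \<xi> u \<omega>) u"
  from positions_given_tree[of n s] obtain c where c: "c \<ge> 0"
    and cD: "\<And>D. (\<forall>k. D \<in> sets (history M \<xi> X k)) \<Longrightarrow>
      prob (states n s \<inter> D) = c * prob (trees n (fst ` s) \<inter> D)" by blast
  have K [measurable]: "?K \<in> M \<rightarrow>\<^sub>M count_space UNIV"
  proof -
    have [measurable]: "(\<lambda>\<omega>. f (\<xi> u \<omega>)) \<in> M \<rightarrow>\<^sub>M count_space UNIV" for f :: "_ \<Rightarrow> nat"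
      by (rule measurable_compose[OF measurable_reproduction]) simp
    show ?thesis unfolding num_children_def case_prod_beta by measurable
  qed
  have layer: "(\<integral>\<^sup>+\<omega>. of_nat (?K \<omega>) * indicator A \<omega> \<partial>M) =
      (\<Sum>t. emeasure M (A \<inter> {\<omega> \<in> space M. u @ [t] \<in> kesten \<xi> \<omega>}))"
    if [measurable]: "A \<in> sets M" and A: "A \<subseteq> trees n (fst ` s)" for A
  proof -
    have "(\<integral>\<^sup>+\<omega>. of_nat (?K \<omega>) * indicator A \<omega> \<partial>M) =
        (\<integral>\<^sup>+\<omega>. of_nat (if \<omega> \<in> A then ?K \<omega> else 0) \<partial>M)"
      by (intro nn_integral_cong) (auto simp: indicator_def)
    also have "\<dots> = (\<Sum>t. emeasure M {\<omega> \<in> space M. t < (if \<omega> \<in> A then ?K \<omega> else 0)})"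
      by (rule nn_integral_nat_function) measurable
    also have "(\<lambda>t. {\<omega> \<in> space M. t < (if \<omega> \<in> A then ?K \<omega> else 0)}) =
        (\<lambda>t. A \<inter> {\<omega> \<in> space M. u @ [t] \<in> kesten \<xi> \<omega>})"
      using A u by (auto simp: fun_eq_iff kesten_def tree_snoc truncate_enat split: if_splits)
    finally show ?thesis .
  qed
  have tree_D: "{\<omega> \<in> space M. u @ [t] \<in> kesten \<xi> \<omega>} \<in> sets (history M \<xi> X k)" for t k
    using history_kesten[of "u @ [t]" k] by (simp add: pred_def)
  have mult: "emeasure M (states n s \<inter> D) = ennreal c * emeasure M (trees n (fst ` s) \<inter> D)"
    if "\<forall>k. D \<in> sets (history M \<xi> X k)" for D
    using cD[OF that] c by (simp add: emeasure_eq_measure ennreal_mult)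
  have sp: "\<forall>k. space M \<in> sets (history M \<xi> X k)"
    using sets.top[of "history M \<xi> X _"] by simp
  have "(\<integral>\<^sup>+\<omega>. of_nat (?K \<omega>) * indicator (states n s) \<omega> \<partial>M) =
      (\<Sum>t. emeasure M (states n s \<inter> {\<omega> \<in> space M. u @ [t] \<in> kesten \<xi> \<omega>}))"
    by (intro layer sets_prune) (auto simp: prune_labelled image_image)
  also have "\<dots> = (\<Sum>t. ennreal c * emeasure M (trees n (fst ` s) \<inter> {\<omega> \<in> space M. u @ [t] \<in> kesten \<xi> \<omega>}))"
    using tree_D by (simp add: mult)
  also have "\<dots> = ennreal c * (\<integral>\<^sup>+\<omega>. of_nat (?K \<omega>) * indicator (trees n (fst ` s)) \<omega> \<partial>M)"
    by (subst layer) (auto intro!: sets_truncate)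
  also have "\<dots> \<le> ennreal c * (ennreal reproduction_bound * emeasure M (trees n (fst ` s)))"
    by (intro mult_left_mono nn_integral_num_children u) simp
  also have "\<dots> = ennreal reproduction_bound * emeasure M (states n s)"
    using mult[OF sp] by (simp add: mult_ac Int_absorb2)
  finally show ?thesis .
qed

end

section \<open>Confinement to a region\<close>

text \<open>Intended for boundary sites of a set without isolated points, where exactly one of the
  two neighbours belongs to \<open>H\<close>.\<close>

definition inward :: "int set \<Rightarrow> int \<Rightarrow> int" where
  "inward H x = (if x + 1 \<in> H then x + 1 else x - 1)"

definition rim :: "int set \<Rightarrow> int set" where
  "rim H = {x \<in> H. x + 1 \<notin> H \<or> x - 1 \<notin> H}"

definition fresh :: "(vertex \<times> int) set \<Rightarrow> nat \<Rightarrow> int \<Rightarrow> nat" where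
  "fresh s n y = card {u. (u, y) \<in> s \<and> length u = n}"

text \<open>Unit steps are part of the condition because \<open>transition\<close> yields them only
  almost surely. Taking \<open>H = UNIV\<close> then expresses precisely that all steps up to
  generation \<open>n\<close> have length one.\<close>

definition confined :: "int set \<Rightarrow> (vertex \<times> int) set \<Rightarrow> nat \<Rightarrow> bool" where
  "confined H s n \<longleftrightarrow> (\<forall>(u, y) \<in> s. length u \<le> n \<longrightarrow>
     y \<in> H \<and> (u = [] \<or> (\<exists>y'. (butlast u, y') \<in> s \<and> \<bar>y - y'\<bar> = 1)))"

lemma fresh_prune: "n \<le> k \<Longrightarrow> fresh (prune k s) n y = fresh s n y"
  unfolding fresh_def by (rule arg_cong[where f = card]) (auto simp: prune_def)

lemma confined_prune:
  assumes "n \<le> k"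
  shows "confined H (prune k s) n \<longleftrightarrow> confined H s n"
proof -
  have "length (butlast u) \<le> k" if "length u \<le> n" for u :: vertex
    using that assms by auto
  then show ?thesis using assms by (fastforce simp: confined_def prune_def)
qed

lemma confined_antimono: "confined H s n \<Longrightarrow> k \<le> n \<Longrightarrow> confined H s k"
  by (fastforce simp: confined_def)

lemma labelled_iff: "(u, y) \<in> labelled \<xi> X \<omega> \<longleftrightarrow> u \<in> kesten \<xi> \<omega> \<and> y = X u \<omega>"
  by (auto simp: labelled_def)

lemma confined_labelled:
  "confined H (labelled \<xi> X \<omega>) n \<longleftrightarrow> (\<forall>u \<in> kesten \<xi> \<omega>. length u \<le> n \<longrightarrow>
     X u \<omega> \<in> H \<and> (u = [] \<or> \<bar>X u \<omega> - X (butlast u) \<omega>\<bar> = 1))"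
  by (auto simp: confined_def labelled_iff intro: butlast_kesten)

lemma finite_generation: "finite {u \<in> kesten \<xi> \<omega>. length u = n}"
  by (rule finite_subset[OF _ finite_truncate_kesten[of \<xi> \<omega> n]]) (auto simp: truncate_enat)

lemma visits_mono:
  assumes "k \<le> n"
  shows "visits (labelled \<xi> X \<omega>) k y \<le> visits (labelled \<xi> X \<omega>) n y"
  unfolding visits_def using assms
  by (intro card_mono finite_subset[OF _ finite_truncate_kesten[of \<xi> \<omega> n]])
    (auto simp: labelled_iff truncate_enat)

lemma visits_eq_sum_fresh:
  "visits (labelled \<xi> X \<omega>) n y = (\<Sum>i\<le>n. fresh (labelled \<xi> X \<omega>) i y)"
proof (induction n)
  case 0
  show ?case by (simp add: visits_def fresh_def)
next
  case (Suc n)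
  let ?s = "labelled \<xi> X \<omega>"
  have "{u. (u, y) \<in> ?s \<and> length u \<le> Suc n} =
      {u. (u, y) \<in> ?s \<and> length u \<le> n} \<union> {u. (u, y) \<in> ?s \<and> length u = Suc n}" by auto
  moreover have "finite {u. (u, y) \<in> ?s \<and> length u \<le> Suc n}"
    by (rule finite_subset[OF _ finite_truncate_kesten[of \<xi> \<omega> "Suc n"]])
      (auto simp: labelled_iff truncate_enat)
  ultimately have "visits ?s (Suc n) y = visits ?s n y + fresh ?s (Suc n) y"
    unfolding visits_def fresh_def by (subst card_Un_disjoint[symmetric]) auto
  then show ?case using Suc by simp
qed

lemma visits_outside:
  assumes "confined H s n" "y \<notin> H"
  shows "visits s n y = 0"
proof -
  have "{u. (u, y) \<in> s \<and> length u \<le> n} = {}"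
    using assms by (auto simp: confined_def)
  then show ?thesis unfolding visits_def by (metis card.empty)
qed

section \<open>Load, intake and potential of a region\<close>

locale vrbrw_region = vrbrw M \<mu> \<xi> w X
  for M :: "'a measure" and \<mu> :: "nat pmf" and \<xi> :: "vertex \<Rightarrow> 'a \<Rightarrow> reproduction"
    and w :: "nat \<Rightarrow> real" and X :: "vertex \<Rightarrow> 'a \<Rightarrow> int" +
  fixes H :: "int set"
  assumes finite_rim: "finite (rim H)"
    and no_isolated: "\<And>x. x \<in> H \<Longrightarrow> x + 1 \<in> H \<or> x - 1 \<in> H"
    and summable_weight: "summable (\<lambda>n. 1 / w n)"
begin

abbreviation lab :: "'a \<Rightarrow> (vertex \<times> int) set" where
  "lab \<equiv> labelled \<xi> X"

abbreviation m :: real where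
  "m \<equiv> reproduction_bound"

text \<open>During confinement the outer neighbour of a boundary site has local time 0, so this is
  the exact probability that a child of a vertex at \<open>x\<close> leaves
  \<open>H\<close>.\<close>

definition exit_prob :: "(vertex \<times> int) set \<Rightarrow> nat \<Rightarrow> int \<Rightarrow> real" where
  "exit_prob s n x = w 0 / (w 0 + w (visits s n (inward H x)))"

definition load :: "(vertex \<times> int) set \<Rightarrow> nat \<Rightarrow> real" where
  "load s n = (\<Sum>x\<in>rim H. exit_prob s n x * fresh s n x)"

text \<open>Up to a factor \<open>m\<close>, \<open>load\<close> bounds the mean number of exits in
  the next generation, and \<open>intake\<close> bounds the mean load one generation later.\<close>

definition intake :: "(vertex \<times> int) set \<Rightarrow> nat \<Rightarrow> real" where
  "intake s n = (\<Sum>x\<in>rim H. exit_prob s n x * fresh s n (inward H x))"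

definition potential :: "(vertex \<times> int) set \<Rightarrow> nat \<Rightarrow> real" where
  "potential s n = (if confined H s n
     then exp (- (2 * m * load s n)) * exp (2 * m\<^sup>2 * (\<Sum>j<n. intake s j)) else 0)"

lemma m_nonneg: "0 \<le> m" using reproduction_bound_ge_one by simp

lemma exit_prob_bounds: "0 \<le> exit_prob s n x" "exit_prob s n x \<le> 1 / 2"
proof -
  let ?z = "visits s n (inward H x)"
  have "w 0 \<le> w ?z" using weight_mono by (auto intro: monoD)
  then show "0 \<le> exit_prob s n x" "exit_prob s n x \<le> 1 / 2"
    using weight_pos[of 0] weight_pos[of ?z] by (auto simp: exit_prob_def field_simps)
qed

lemma load_prune: "n \<le> k \<Longrightarrow> load (prune k s) n = load s n"
  by (simp add: load_def exit_prob_def visits_prune fresh_prune)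

lemma intake_prune: "n \<le> k \<Longrightarrow> intake (prune k s) n = intake s n"
  by (simp add: intake_def exit_prob_def visits_prune fresh_prune)

lemma potential_prune: "n \<le> k \<Longrightarrow> potential (prune k s) n = potential s n"
  by (simp add: potential_def confined_prune load_prune intake_prune)

definition exit_rate :: real where
  "exit_rate = card (rim H) * (w 0 * (\<Sum>n. 1 / w n))"

text \<open>Dropping \<open>w 0\<close> from the denominator leaves \<open>w 0\<close> times the new
  visits at the inner neighbour over \<open>w\<close> of its local time. The local time includes the
  current generation, which matches the inclusive inner sum in \<open>sum_inverse_weight_le\<close>.
  The bound holds on every path.\<close>

lemma sum_intake_le: "(\<Sum>j<n. intake (lab \<omega>) j) \<le> exit_rate"
proof -
  let ?s = "lab \<omega>"
  have "(\<Sum>j<n. exit_prob ?s j x * fresh ?s j (inward H x)) \<le> w 0 * (\<Sum>n. 1 / w n)" for x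
  proof -
    let ?g = "\<lambda>j. fresh ?s j (inward H x)"
    have "(\<Sum>j<n. exit_prob ?s j x * ?g j) \<le> (\<Sum>j<n. w 0 * (real (?g j) / w (\<Sum>i\<le>j. ?g i)))"
    proof (rule sum_mono)
      fix j
      have "exit_prob ?s j x \<le> w 0 / w (visits ?s j (inward H x))"
        unfolding exit_prob_def using weight_pos less_imp_le[OF weight_pos]
        by (intro divide_left_mono) (auto intro!: mult_pos_pos add_pos_pos)
      then have "exit_prob ?s j x * ?g j \<le> w 0 / w (visits ?s j (inward H x)) * ?g j"
        by (rule mult_right_mono) simp
      then show "exit_prob ?s j x * ?g j \<le> w 0 * (real (?g j) / w (\<Sum>i\<le>j. ?g i))"
        by (simp add: visits_eq_sum_fresh)
    qed
    also have "\<dots> = w 0 * (\<Sum>j<n. real (?g j) / w (\<Sum>i\<le>j. ?g i))" by (simp add: sum_distrib_left)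
    also have "\<dots> \<le> w 0 * (\<Sum>k<Suc (\<Sum>j<n. ?g j). 1 / w k)"
      by (intro mult_left_mono sum_inverse_weight_le weight_mono weight_pos less_imp_le[OF weight_pos])
    also have "\<dots> \<le> w 0 * (\<Sum>n. 1 / w n)"
      using weight_pos by (intro mult_left_mono sum_le_suminf summable_weight) (auto simp: less_imp_le)
    finally show ?thesis .
  qed
  then have "(\<Sum>x\<in>rim H. \<Sum>j<n. exit_prob ?s j x * fresh ?s j (inward H x)) \<le>
      (\<Sum>x\<in>rim H. w 0 * (\<Sum>n. 1 / w n))" by (rule sum_mono)
  also have "(\<Sum>x\<in>rim H. \<Sum>j<n. exit_prob ?s j x * fresh ?s j (inward H x)) = (\<Sum>j<n. intake ?s j)"
    unfolding intake_def by (rule sum.swap)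
  finally show ?thesis by (simp add: exit_rate_def)
qed

text \<open>The outer neighbour of a boundary site is not in \<open>H\<close>, so every vertex found
  there has its parent at the inner neighbour. Growing local time only lowers
  \<open>exit_prob\<close>, so the old value may be kept in the bound.\<close>

lemma confined_next:
  assumes conf: "confined H (lab \<omega>) n"
    and next_gen: "\<And>v. v \<in> kesten \<xi> \<omega> \<Longrightarrow> length v = Suc n \<Longrightarrow>
      X v \<omega> \<in> H \<and> \<bar>X v \<omega> - X (butlast v) \<omega>\<bar> = 1"
  shows "confined H (lab \<omega>) (Suc n)"
    and "load (lab \<omega>) (Suc n) \<le> (\<Sum>x\<in>rim H. exit_prob (lab \<omega>) n x *
      card {v \<in> kesten \<xi> \<omega>. length v = Suc n \<and> X (butlast v) \<omega> = inward H x})"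
proof -
  show conf': "confined H (lab \<omega>) (Suc n)"
    using conf next_gen by (auto simp: confined_labelled le_Suc_eq)
  show "load (lab \<omega>) (Suc n) \<le> (\<Sum>x\<in>rim H. exit_prob (lab \<omega>) n x *
      card {v \<in> kesten \<xi> \<omega>. length v = Suc n \<and> X (butlast v) \<omega> = inward H x})"
    unfolding load_def
  proof (rule sum_mono)
    fix x assume x: "x \<in> rim H"
    have "w (visits (lab \<omega>) n (inward H x)) \<le> w (visits (lab \<omega>) (Suc n) (inward H x))"
      by (intro monoD[OF weight_mono] visits_mono) simp
    then have "exit_prob (lab \<omega>) (Suc n) x \<le> exit_prob (lab \<omega>) n x"
      unfolding exit_prob_def using weight_pos less_imp_le[OF weight_pos]
      by (intro divide_left_mono) (auto intro!: mult_pos_pos add_pos_pos)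
    moreover have "fresh (lab \<omega>) (Suc n) x \<le>
        card {v \<in> kesten \<xi> \<omega>. length v = Suc n \<and> X (butlast v) \<omega> = inward H x}"
      unfolding fresh_def
    proof (rule card_mono)
      show "{u. (u, x) \<in> lab \<omega> \<and> length u = Suc n} \<subseteq>
          {v \<in> kesten \<xi> \<omega>. length v = Suc n \<and> X (butlast v) \<omega> = inward H x}"
      proof safe
        fix v assume v: "(v, x) \<in> lab \<omega>" "length v = Suc n"
        then have vT: "v \<in> kesten \<xi> \<omega>" and xv: "x = X v \<omega>" by (auto simp: labelled_iff)
        show "v \<in> kesten \<xi> \<omega>" by (rule vT)
        have "butlast v \<in> kesten \<xi> \<omega>" using v(2) by (intro butlast_kesten vT) auto
        then have "X (butlast v) \<omega> \<in> H" using conf v(2) by (auto simp: confined_labelled)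
        moreover have "\<bar>x - X (butlast v) \<omega>\<bar> = 1" using next_gen[OF vT v(2)] xv by simp
        then have "X (butlast v) \<omega> = x + 1 \<or> X (butlast v) \<omega> = x - 1" by linarith
        ultimately show "X (butlast v) \<omega> = inward H x" using x no_isolated[of x]
          by (auto simp: inward_def rim_def)
      qed
      show "finite {v \<in> kesten \<xi> \<omega>. length v = Suc n \<and> X (butlast v) \<omega> = inward H x}"
        by (rule finite_subset[OF _ finite_generation[of \<xi> \<omega> "Suc n"]]) auto
    qed
    ultimately show "exit_prob (lab \<omega>) (Suc n) x * fresh (lab \<omega>) (Suc n) x \<le> exit_prob (lab \<omega>) n x *
      card {v \<in> kesten \<xi> \<omega>. length v = Suc n \<and> X (butlast v) \<omega> = inward H x}"
      using exit_prob_bounds by (intro mult_mono) auto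
  qed
qed

text \<open>Writing the exponent as a sum over the boundary treats all sites uniformly: away from it
  the exponent is 0 and both neighbours are allowed; on it, the probability is one minus
  \<open>exit_prob\<close>.\<close>

lemma stay_prob:
  assumes conf: "confined H s n" and q: "q \<in> H"
  shows "exp (- (2 * (\<Sum>x\<in>rim H. exit_prob s n x * of_bool (x = q)))) \<le>
    (\<Sum>y | y \<in> H \<and> \<bar>y - q\<bar> = 1. jump w s n q y)"
proof -
  have sum: "(\<Sum>x\<in>rim H. exit_prob s n x * of_bool (x = q)) = (if q \<in> rim H then exit_prob s n q else 0)"
    using finite_rim by (simp add: of_bool_def if_distrib sum.delta cong: if_cong)
  have nb: "{y. y \<in> H \<and> \<bar>y - q\<bar> = 1} = {q - 1, q + 1} \<inter> H" by auto
  have w: "w a + w b \<noteq> 0" for a b using add_pos_pos[OF weight_pos[of a] weight_pos[of b]] by simp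
  show ?thesis
  proof (cases "q \<in> rim H")
    case False
    then have "{y. y \<in> H \<and> \<bar>y - q\<bar> = 1} = {q - 1, q + 1}" using q by (auto simp: nb rim_def)
    then have "(\<Sum>y | y \<in> H \<and> \<bar>y - q\<bar> = 1. jump w s n q y) = 1"
      using w by (simp add: jump_def add_divide_distrib[symmetric])
    then show ?thesis using False by (simp add: sum)
  next
    case True
    then have "inward H q \<in> H" "2 * q - inward H q \<notin> H" and iq: "inward H q = q + 1 \<or> inward H q = q - 1"
      using no_isolated[OF q] by (auto simp: inward_def rim_def)
    then have eq: "{y. y \<in> H \<and> \<bar>y - q\<bar> = 1} = {inward H q}" by (auto simp: nb)
    \<comment> \<open>\<open>2 * q - inward H q\<close> is the reflection of the inner neighbour in
      \<open>q\<close>, hence the outer one.\<close>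
    have out: "visits s n (2 * q - inward H q) = 0" by (rule visits_outside[OF conf]) fact
    have "jump w s n q (inward H q) = 1 - exit_prob s n q"
      using iq
    proof
      assume i: "inward H q = q + 1"
      have "visits s n (q - 1) = 0" using out by (simp add: i)
      then show ?thesis using w[of 0 "visits s n (q + 1)"]
        unfolding exit_prob_def i by (simp add: jump_def field_simps)
    next
      assume i: "inward H q = q - 1"
      have "2 * q - (q - 1) = q + 1" by simp
      then have "visits s n (q + 1) = 0" using out unfolding i by simp
      then show ?thesis using w[of 0 "visits s n (q - 1)"]
        unfolding exit_prob_def i by (simp add: jump_def field_simps)
    qed
    then show ?thesis using True one_minus_ge_exp[OF exit_prob_bounds] by (simp add: sum eq)
  qed
qed

text \<open>The cost in the exponent of one child of a vertex at \<open>q\<close>: the child may leave \<open>H\<close> at once,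
  or else it may add to the load of the next generation.\<close>

definition pressure :: "(vertex \<times> int) set \<Rightarrow> nat \<Rightarrow> int \<Rightarrow> real" where
  "pressure s n q = (\<Sum>x\<in>rim H. exit_prob s n x * (2 * of_bool (x = q) + 2 * m * of_bool (inward H x = q)))"

lemma pressure_nonneg: "0 \<le> pressure s n q"
  unfolding pressure_def using exit_prob_bounds(1) m_nonneg by (intro sum_nonneg mult_nonneg_nonneg) auto

lemma sum_pressure:
  assumes "finite U"
  shows "(\<Sum>u\<in>U. pressure s n (f u)) = (\<Sum>x\<in>rim H. exit_prob s n x *
    (2 * card {u \<in> U. f u = x} + 2 * m * card {u \<in> U. f u = inward H x}))"
proof -
  have card: "real (card {u \<in> U. f u = c}) = (\<Sum>u\<in>U. of_bool (c = f u))" for c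
    using assms by (simp add: of_bool_def sum.If_cases Int_def eq_commute)
  show ?thesis
    unfolding pressure_def of_nat_mult of_nat_numeral card
    by (subst sum.swap) (simp only: sum_distrib_left sum.distrib distrib_left)
qed

section \<open>One-step growth of the potential\<close>

lemma pred_prune: "Measurable.pred M (\<lambda>\<omega>. P (prune n (lab \<omega>)))"
  by (rule measurable_compose[OF measurable_prune]) simp

lemma measurable_potential [measurable]: "(\<lambda>\<omega>. potential (lab \<omega>) n) \<in> borel_measurable M"
proof -
  have "(\<lambda>\<omega>. potential (prune n (lab \<omega>)) n) \<in> borel_measurable M"
    by (rule measurable_compose[OF measurable_prune]) simp
  then show ?thesis by (simp add: potential_prune)
qed

lemma pred_confined [measurable]: "Measurable.pred M (\<lambda>\<omega>. confined H (lab \<omega>) n)"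
  using pred_prune[of "\<lambda>s. confined H s n" n] by (simp add: confined_prune)

definition pressure_next :: "(vertex \<times> int) set \<Rightarrow> nat \<Rightarrow> vertex set \<Rightarrow> real" where
  "pressure_next s n t = (\<Sum>v | v \<in> t \<and> length v = Suc n. pressure s n (pos s (butlast v)))"

text \<open>With state and offspring fixed, the only randomness left is in the independent moves of
  the children. The probability that all stay in \<open>H\<close> costs one part of the pressure;
  once they stay, the next load is bounded by a quantity already fixed by the offspring, which costs
  the other part.\<close>

lemma potential_given_offspring:
  assumes conf: "confined H s n" and t: "finite t"
  shows "ennreal (exp (- pressure_next s n t) * exp (2 * m\<^sup>2 * (\<Sum>j<Suc n. intake s j))) *
      emeasure M (states n s \<inter> trees (Suc n) t)
    \<le> (\<integral>\<^sup>+\<omega>. ennreal (potential (lab \<omega>) (Suc n)) * indicator (states n s \<inter> trees (Suc n) t) \<omega> \<partial>M)"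
proof -
  define V where "V = {v \<in> t. length v = Suc n}"
  define Y where "Y v = {y. y \<in> H \<and> \<bar>y - pos s (butlast v)\<bar> = 1}" for v
  define \<psi> where "\<psi> = exp (2 * m\<^sup>2 * (\<Sum>j<Suc n. intake s j))"
  \<comment> \<open>\<open>a\<close> bounds the next load by assuming that every child of a vertex
    at an inner neighbour moves to the boundary; \<open>b\<close> adds up the exit probabilities of
    the children born on the boundary.\<close>
  define a where "a = (\<Sum>x\<in>rim H. exit_prob s n x * card {v \<in> V. pos s (butlast v) = inward H x})"
  define b where "b = (\<Sum>v\<in>V. \<Sum>x\<in>rim H. exit_prob s n x * of_bool (x = pos s (butlast v)))"
  let ?D = "states n s \<inter> trees (Suc n) t"
  let ?\<Gamma> = "?D \<inter> {\<omega> \<in> space M. \<forall>v\<in>V. X v \<omega> \<in> Y v}"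
  note [measurable] = measurable_position sets_prune sets_truncate
  have finV: "finite V" using t by (simp add: V_def)
  have finY: "finite (Y v)" for v
    by (rule finite_subset[of _ "{pos s (butlast v) - 1, pos s (butlast v) + 1}"]) (auto simp: Y_def)
  have [measurable]: "{\<omega> \<in> space M. \<forall>v\<in>V. X v \<omega> \<in> Y v} \<in> sets M"
    using finV by measurable
  have pn: "pressure_next s n t = 2 * b + 2 * m * a"
  proof -
    have "pressure_next s n t = (\<Sum>x\<in>rim H. exit_prob s n x *
      (2 * card {v \<in> V. pos s (butlast v) = x} + 2 * m * card {v \<in> V. pos s (butlast v) = inward H x}))"
      unfolding pressure_next_def V_def[symmetric] by (rule sum_pressure[OF finV])
    moreover have "b = (\<Sum>x\<in>rim H. exit_prob s n x * card {v \<in> V. pos s (butlast v) = x})"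
    proof -
      have "real (card {v \<in> V. pos s (butlast v) = c}) = (\<Sum>v\<in>V. of_bool (c = pos s (butlast v)))" for c
        using finV by (simp add: of_bool_def sum.If_cases Int_def eq_commute)
      then show ?thesis unfolding b_def by (subst sum.swap) (simp add: sum_distrib_left)
    qed
    ultimately show ?thesis
      by (simp add: a_def distrib_left sum.distrib sum_distrib_left mult_ac)
  qed
  have pos_H: "pos s (butlast v) \<in> H" if "v \<in> V" "?D \<noteq> {}" for v
  proof -
    from that obtain \<omega> where \<omega>: "\<omega> \<in> ?D" by auto
    then have v: "v \<in> kesten \<xi> \<omega>" "length v = Suc n" and s: "s = prune n (lab \<omega>)"
      using that by (auto simp: V_def truncate_enat)
    note bl = butlast_truncate_kesten[OF v]
    show ?thesis using bl conf unfolding s pos_prune_labelled[OF bl]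
      by (auto simp: confined_prune confined_labelled truncate_enat)
  qed
  have "exp (- (2 * b)) * prob ?D \<le> prob ?\<Gamma>"
  proof (cases "?D = {}")
    case False
    have "exp (- (2 * b)) = (\<Prod>v\<in>V. exp (- (2 * (\<Sum>x\<in>rim H. exit_prob s n x * of_bool (x = pos s (butlast v))))))"
      using finV by (simp add: b_def exp_sum[symmetric] sum_distrib_left sum_negf)
    also have "\<dots> \<le> (\<Prod>v\<in>V. \<Sum>y\<in>Y v. jump w s n (pos s (butlast v)) y)"
      unfolding Y_def using pos_H[OF _ False] by (intro prod_mono conjI stay_prob conf) auto
    finally show ?thesis
      using prob_next_positions_in[OF V_def finY, of s] by (simp add: mult_right_mono)
  qed (simp only: measure_empty Int_empty_left)
  then have "(exp (- (2 * m * a)) * \<psi>) * (exp (- (2 * b)) * prob ?D) \<le>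
      (exp (- (2 * m * a)) * \<psi>) * prob ?\<Gamma>"
    by (rule mult_left_mono) (simp add: \<psi>_def)
  moreover have "exp (- pressure_next s n t) = exp (- (2 * m * a)) * exp (- (2 * b))"
    by (simp add: pn mult_exp_exp)
  ultimately have "(exp (- pressure_next s n t) * \<psi>) * prob ?D \<le> (exp (- (2 * m * a)) * \<psi>) * prob ?\<Gamma>"
    by (simp add: mult_ac)
  then have "ennreal (exp (- pressure_next s n t) * \<psi>) * emeasure M ?D \<le>
      ennreal (exp (- (2 * m * a)) * \<psi>) * emeasure M ?\<Gamma>"
    unfolding emeasure_eq_measure
    by (subst (1 2) ennreal_mult[symmetric]) (auto simp: \<psi>_def intro!: ennreal_leI)
  also have "\<dots> = (\<integral>\<^sup>+\<omega>. ennreal (exp (- (2 * m * a)) * \<psi>) * indicator ?\<Gamma> \<omega> \<partial>M)"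
    by (subst nn_integral_cmult_indicator) auto
  also have "\<dots> \<le> (\<integral>\<^sup>+\<omega>. ennreal (potential (lab \<omega>) (Suc n)) * indicator ?D \<omega> \<partial>M)"
  proof (rule nn_integral_mono)
    fix \<omega>
    show "ennreal (exp (- (2 * m * a)) * \<psi>) * indicator ?\<Gamma> \<omega> \<le>
      ennreal (potential (lab \<omega>) (Suc n)) * indicator ?D \<omega>"
    proof (cases "\<omega> \<in> ?\<Gamma>")
      case True
      then have s: "s = prune n (lab \<omega>)" and tr: "truncate (kesten \<xi> \<omega>) (enat (Suc n)) = t"
        and XY: "\<And>v. v \<in> V \<Longrightarrow> X v \<omega> \<in> Y v" by auto
      have V: "V = {v \<in> kesten \<xi> \<omega>. length v = Suc n}"
        unfolding V_def tr[symmetric] truncate_enat by auto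
      have posX: "pos s (butlast v) = X (butlast v) \<omega>" if "v \<in> V" for v
        using that unfolding s V by (intro pos_prune_labelled butlast_truncate_kesten) auto
      have ng: "X v \<omega> \<in> H \<and> \<bar>X v \<omega> - X (butlast v) \<omega>\<bar> = 1"
        if "v \<in> kesten \<xi> \<omega>" "length v = Suc n" for v
        using XY[of v] posX[of v] that by (auto simp: V Y_def)
      have conf\<omega>: "confined H (lab \<omega>) n" using conf by (simp add: s confined_prune)
      have "{v \<in> V. pos s (butlast v) = inward H x} =
          {v \<in> kesten \<xi> \<omega>. length v = Suc n \<and> X (butlast v) \<omega> = inward H x}" for x
        using posX by (auto simp: V)
      then have "load (lab \<omega>) (Suc n) \<le> a"
        using confined_next(2)[OF conf\<omega> ng] by (simp add: a_def s exit_prob_def visits_prune)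
      then have "exp (- (2 * m * a)) \<le> exp (- (2 * m * load (lab \<omega>) (Suc n)))"
        using m_nonneg by (simp add: mult_left_mono)
      moreover have "\<psi> = exp (2 * m\<^sup>2 * (\<Sum>j<Suc n. intake (lab \<omega>) j))"
        unfolding \<psi>_def s by (simp add: intake_prune)
      ultimately have "exp (- (2 * m * a)) * \<psi> \<le> potential (lab \<omega>) (Suc n)"
        using confined_next(1)[OF conf\<omega> ng] by (simp add: potential_def)
      then show ?thesis using True by (simp add: ennreal_leI)
    qed simp
  qed
  finally show ?thesis unfolding \<psi>_def .
qed

lemma sum_parent_eq_sum_children:
  assumes "\<omega> \<in> states n s"
  shows "(\<Sum>v | v \<in> kesten \<xi> \<omega> \<and> length v = Suc n. f (butlast v)) =
    (\<Sum>u | u \<in> fst ` s \<and> length u = n. f u * real (num_children (\<lambda>u. \<xi> u \<omega>) u))"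
proof -
  have U: "{u. u \<in> fst ` s \<and> length u = n} = {u \<in> kesten \<xi> \<omega>. length u = n}"
    using assms by (auto simp: prune_labelled image_image truncate_enat)
  let ?U = "{u \<in> kesten \<xi> \<omega>. length u = n}" and ?K = "num_children (\<lambda>u. \<xi> u \<omega>)"
  have img: "{v. v \<in> kesten \<xi> \<omega> \<and> length v = Suc n} = (\<lambda>(u, i). u @ [i]) ` (SIGMA u:?U. {..<?K u})"
  proof (intro equalityI subsetI)
    fix v assume "v \<in> {v. v \<in> kesten \<xi> \<omega> \<and> length v = Suc n}"
    then show "v \<in> (\<lambda>(u, i). u @ [i]) ` (SIGMA u:?U. {..<?K u})"
      by (cases v rule: rev_cases) (auto simp: kesten_def tree_snoc intro!: rev_image_eqI)
  qed (auto simp: kesten_def tree_snoc)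
  have "(\<Sum>v | v \<in> kesten \<xi> \<omega> \<and> length v = Suc n. f (butlast v)) =
      (\<Sum>(u, i)\<in>(SIGMA u:?U. {..<?K u}). f u)"
    unfolding img by (subst sum.reindex) (auto simp: inj_on_def case_prod_beta)
  also have "\<dots> = (\<Sum>u\<in>?U. \<Sum>i<?K u. f u)"
    by (rule sum.Sigma[symmetric]) (auto simp: finite_generation)
  finally show ?thesis unfolding U by (simp add: mult.commute)
qed

lemma pressure_next_truncate:
  "pressure_next s n (truncate (kesten \<xi> \<omega>) (enat (Suc n))) =
    (\<Sum>v | v \<in> kesten \<xi> \<omega> \<and> length v = Suc n. pressure s n (pos s (butlast v)))"
  unfolding pressure_next_def by (rule sum.cong) (auto simp: truncate_enat)

lemma measurable_pressure_next [measurable]: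
  "(\<lambda>\<omega>. pressure_next s n (truncate (kesten \<xi> \<omega>) (enat (Suc n)))) \<in> borel_measurable M"
  by (rule measurable_compose[OF measurable_truncate]) simp

lemma pressure_next_nonneg: "0 \<le> pressure_next s n t"
  unfolding pressure_next_def by (intro sum_nonneg pressure_nonneg)

lemma sum_pressure_state:
  assumes "states n s \<noteq> {}"
  shows "(\<Sum>u | u \<in> fst ` s \<and> length u = n. pressure s n (pos s u)) = 2 * load s n + 2 * m * intake s n"
proof -
  from assms obtain \<omega> where s: "s = prune n (lab \<omega>)" by auto
  let ?U = "{u. u \<in> fst ` s \<and> length u = n}"
  have fin: "finite ?U"
    using finite_prune_labelled[of n \<xi> X \<omega>] by (simp add: s)
  have "fresh s n x = card {u \<in> ?U. pos s u = x}" for x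
    unfolding fresh_def
  proof (rule arg_cong[where f = card], safe)
    fix u assume u: "(u, x) \<in> s" "n = length u"
    then show "u \<in> fst ` s" by force
    have "u \<in> truncate (kesten \<xi> \<omega>) (enat n)" "x = X u \<omega>" using u by (auto simp: s prune_labelled)
    then show "pos s u = x" by (simp add: s pos_prune_labelled)
  next
    fix u y assume u: "(u, y) \<in> s" "x = pos s (fst (u, y))" "n = length (fst (u, y))"
    then have "u \<in> truncate (kesten \<xi> \<omega>) (enat n)" "y = X u \<omega>" by (auto simp: s prune_labelled)
    then show "(fst (u, y), pos s (fst (u, y))) \<in> s" using u by (simp add: s pos_prune_labelled)
  qed
  then show ?thesis
    unfolding sum_pressure[OF fin] load_def intake_def
    by (simp add: distrib_left sum.distrib sum_distrib_left mult_ac)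
qed

text \<open>After grouping children by parent, the total pressure is linear in the offspring numbers
  with coefficients fixed by \<open>s\<close>. Hence only the mean bound on each state is used, and
  no independence between vertices.\<close>

lemma nn_integral_pressure_next:
  "(\<integral>\<^sup>+\<omega>. ennreal (pressure_next s n (truncate (kesten \<xi> \<omega>) (enat (Suc n)))) * indicator (states n s) \<omega> \<partial>M)
    \<le> ennreal (m * (2 * load s n + 2 * m * intake s n)) * emeasure M (states n s)"
proof (cases "states n s = {}")
  case False
  let ?U = "{u. u \<in> fst ` s \<and> length u = n}" and ?g = "\<lambda>u. pressure s n (pos s u)"
  let ?K = "\<lambda>u \<omega>. num_children (\<lambda>u. \<xi> u \<omega>) u"
  have [measurable]: "?K u \<in> M \<rightarrow>\<^sub>M count_space UNIV" for u
  proof -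
    have [measurable]: "(\<lambda>\<omega>. f (\<xi> u \<omega>)) \<in> M \<rightarrow>\<^sub>M count_space UNIV" for f :: "_ \<Rightarrow> nat"
      by (rule measurable_compose[OF measurable_reproduction]) simp
    show ?thesis unfolding num_children_def case_prod_beta by measurable
  qed
  note [measurable] = sets_prune
  have "(\<integral>\<^sup>+\<omega>. ennreal (pressure_next s n (truncate (kesten \<xi> \<omega>) (enat (Suc n)))) * indicator (states n s) \<omega> \<partial>M) =
      (\<integral>\<^sup>+\<omega>. (\<Sum>u\<in>?U. ennreal (?g u) * (of_nat (?K u \<omega>) * indicator (states n s) \<omega>)) \<partial>M)"
  proof (rule nn_integral_cong)
    fix \<omega>
    show "ennreal (pressure_next s n (truncate (kesten \<xi> \<omega>) (enat (Suc n)))) * indicator (states n s) \<omega> =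
      (\<Sum>u\<in>?U. ennreal (?g u) * (of_nat (?K u \<omega>) * indicator (states n s) \<omega>))"
    proof (cases "\<omega> \<in> states n s")
      case True
      have "ennreal (\<Sum>u\<in>?U. ?g u * real (?K u \<omega>)) = (\<Sum>u\<in>?U. ennreal (?g u * real (?K u \<omega>)))"
        by (intro sum_ennreal[symmetric] mult_nonneg_nonneg pressure_nonneg) auto
      then show ?thesis
        unfolding pressure_next_truncate sum_parent_eq_sum_children[OF True, of ?g] using True
        by (simp add: ennreal_mult pressure_nonneg ennreal_of_nat_eq_real_of_nat)
    qed simp
  qed
  also have "\<dots> = (\<Sum>u\<in>?U. ennreal (?g u) * (\<integral>\<^sup>+\<omega>. of_nat (?K u \<omega>) * indicator (states n s) \<omega> \<partial>M))"
    by (subst nn_integral_sum) (auto simp: nn_integral_cmult)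
  also have "\<dots> \<le> (\<Sum>u\<in>?U. ennreal (?g u) * (ennreal m * emeasure M (states n s)))"
    by (intro sum_mono mult_left_mono nn_integral_num_children_state) auto
  also have "\<dots> = ennreal (\<Sum>u\<in>?U. ?g u) * (ennreal m * emeasure M (states n s))"
    by (simp add: sum_distrib_right[symmetric] sum_ennreal pressure_nonneg)
  also have "\<dots> = ennreal (m * (2 * load s n + 2 * m * intake s n)) * emeasure M (states n s)"
    unfolding sum_pressure_state[OF False, symmetric]
    by (simp add: ennreal_mult m_nonneg sum_nonneg pressure_nonneg mult_ac)
  finally show ?thesis .
qed simp

text \<open>Jensen's inequality for the exponential is used in the form \<open>exp z \<ge> 1 + z\<close>, so that only
  the mean offspring matters.\<close>

lemma potential_step:
  "(\<integral>\<^sup>+\<omega>. ennreal (potential (lab \<omega>) n) * indicator (states n s) \<omega> \<partial>M) \<le>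
    (\<integral>\<^sup>+\<omega>. ennreal (potential (lab \<omega>) (Suc n)) * indicator (states n s) \<omega> \<partial>M)"
proof -
  have const: "(\<integral>\<^sup>+\<omega>. ennreal (potential (lab \<omega>) n) * indicator (states n s) \<omega> \<partial>M) =
      ennreal (potential s n) * emeasure M (states n s)"
  proof -
    have "(\<integral>\<^sup>+\<omega>. ennreal (potential (lab \<omega>) n) * indicator (states n s) \<omega> \<partial>M) =
        (\<integral>\<^sup>+\<omega>. ennreal (potential s n) * indicator (states n s) \<omega> \<partial>M)"
      by (intro nn_integral_cong) (auto simp: indicator_def potential_prune)
    then show ?thesis by (simp add: nn_integral_cmult_indicator sets_prune)
  qed
  show ?thesis
  proof (cases "confined H s n \<and> states n s \<noteq> {}")
    case False
    have "ennreal (potential s n) * emeasure M (states n s) = 0"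
    proof (cases "confined H s n")
      case True
      then have "states n s = {}" using False by blast
      then show ?thesis by (simp only: emeasure_empty mult_zero_right)
    qed (simp add: potential_def)
    then show ?thesis unfolding const by (simp only: zero_le)
  next
    case True
    then have conf: "confined H s n" by simp
    note [measurable] = sets_prune sets_truncate
    let ?P = "emeasure M (states n s)"
    let ?Y = "\<lambda>\<omega>. pressure_next s n (truncate (kesten \<xi> \<omega>) (enat (Suc n)))"
    define \<psi> where "\<psi> = exp (2 * m\<^sup>2 * (\<Sum>j<Suc n. intake s j))"
    define a where "a = m * (2 * load s n + 2 * m * intake s n)"
    have a0: "0 \<le> a" unfolding a_def load_def intake_def using m_nonneg exit_prob_bounds(1)
      by (intro mult_nonneg_nonneg add_nonneg_nonneg sum_nonneg) auto
    have "(\<integral>\<^sup>+\<omega>. ennreal (exp (- ?Y \<omega>) * \<psi>) * indicator (states n s) \<omega> \<partial>M) \<le>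
        (\<integral>\<^sup>+\<omega>. ennreal (potential (lab \<omega>) (Suc n)) * indicator (states n s) \<omega> \<partial>M)"
    proof (rule nn_integral_mono_fibres[OF measurable_truncate[of "Suc n"] countable_Collect_finite])
      fix t :: "vertex set" assume "t \<in> Collect finite"
      then have t: "finite t" by simp
      have "(\<integral>\<^sup>+\<omega>. ennreal (exp (- ?Y \<omega>) * \<psi>) * indicator (states n s) \<omega> * indicator (trees (Suc n) t) \<omega> \<partial>M) =
          (\<integral>\<^sup>+\<omega>. ennreal (exp (- pressure_next s n t) * \<psi>) * indicator (states n s \<inter> trees (Suc n) t) \<omega> \<partial>M)"
        by (intro nn_integral_cong) (auto simp: indicator_def)
      also have "\<dots> = ennreal (exp (- pressure_next s n t) * \<psi>) * emeasure M (states n s \<inter> trees (Suc n) t)"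
        by (rule nn_integral_cmult_indicator) measurable
      also have "\<dots> \<le> (\<integral>\<^sup>+\<omega>. ennreal (potential (lab \<omega>) (Suc n)) *
          indicator (states n s \<inter> trees (Suc n) t) \<omega> \<partial>M)"
        unfolding \<psi>_def by (rule potential_given_offspring[OF conf t])
      also have "\<dots> = (\<integral>\<^sup>+\<omega>. ennreal (potential (lab \<omega>) (Suc n)) * indicator (states n s) \<omega> *
          indicator (trees (Suc n) t) \<omega> \<partial>M)"
        by (intro nn_integral_cong) (auto simp: indicator_def)
      finally show "(\<integral>\<^sup>+\<omega>. ennreal (exp (- ?Y \<omega>) * \<psi>) * indicator (states n s) \<omega> * indicator (trees (Suc n) t) \<omega> \<partial>M)
        \<le> (\<integral>\<^sup>+\<omega>. ennreal (potential (lab \<omega>) (Suc n)) * indicator (states n s) \<omega> *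
          indicator (trees (Suc n) t) \<omega> \<partial>M)" .
    qed measurable
    moreover have "ennreal (exp (- a) * \<psi>) * ?P \<le>
        (\<integral>\<^sup>+\<omega>. ennreal (exp (- ?Y \<omega>) * \<psi>) * indicator (states n s) \<omega> \<partial>M)" (is "_ \<le> ?I")
    proof -
      \<comment> \<open>The desired inequality is proved with the finite term
        \<open>exp (- a) * \<psi> * a\<close> times the mass added on both sides, since subtraction
        is unsafe in \<open>ennreal\<close>; the term is cancelled at the end.\<close>
      have "ennreal (exp (- a) * \<psi>) * ?P + ennreal (exp (- a) * \<psi> * a) * ?P =
          (\<integral>\<^sup>+\<omega>. ennreal (exp (- a) * \<psi> * (1 + a)) * indicator (states n s) \<omega> \<partial>M)"
        using a0 by (subst nn_integral_cmult_indicator)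
          (auto simp: distrib_left ennreal_plus \<psi>_def distrib_right)
      also have "\<dots> \<le> (\<integral>\<^sup>+\<omega>. ennreal (exp (- ?Y \<omega>) * \<psi>) * indicator (states n s) \<omega> +
          ennreal (exp (- a) * \<psi>) * (ennreal (?Y \<omega>) * indicator (states n s) \<omega>) \<partial>M)"
      proof (rule nn_integral_mono)
        fix \<omega>
        have "exp (- a) * \<psi> * (1 + a) \<le> exp (- ?Y \<omega>) * \<psi> + exp (- a) * \<psi> * ?Y \<omega>"
        proof -
          \<comment> \<open>Tangent line of \<open>exp (- z)\<close> at \<open>z = a\<close>, where
            \<open>a\<close> bounds the mean of \<open>?Y\<close> on the state.\<close>
          have "1 + (a - ?Y \<omega>) \<le> exp (a - ?Y \<omega>)" by (rule exp_ge_add_one_self)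
          then have "exp (- a) * \<psi> * (1 + (a - ?Y \<omega>)) \<le> exp (- a) * \<psi> * exp (a - ?Y \<omega>)"
            by (rule mult_left_mono) (simp add: \<psi>_def)
          also have "\<dots> = exp (- ?Y \<omega>) * \<psi>" by (simp add: mult.assoc mult.left_commute[of \<psi>] mult_exp_exp mult.commute[of _ \<psi>])
          finally show ?thesis by (simp add: algebra_simps)
        qed
        then have "ennreal (exp (- a) * \<psi> * (1 + a)) \<le>
            ennreal (exp (- ?Y \<omega>) * \<psi>) + ennreal (exp (- a) * \<psi>) * ennreal (?Y \<omega>)"
          by (simp add: \<psi>_def pressure_next_nonneg ennreal_leI
              flip: ennreal_plus ennreal_mult)
        then show "ennreal (exp (- a) * \<psi> * (1 + a)) * indicator (states n s) \<omega> \<le>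
            ennreal (exp (- ?Y \<omega>) * \<psi>) * indicator (states n s) \<omega> +
            ennreal (exp (- a) * \<psi>) * (ennreal (?Y \<omega>) * indicator (states n s) \<omega>)"
          by (auto simp: indicator_def)
      qed
      also have "\<dots> = ?I + ennreal (exp (- a) * \<psi>) *
          (\<integral>\<^sup>+\<omega>. ennreal (?Y \<omega>) * indicator (states n s) \<omega> \<partial>M)"
        by (subst nn_integral_add) (auto simp: nn_integral_cmult)
      also have "\<dots> \<le> ?I + ennreal (exp (- a) * \<psi>) * (ennreal a * ?P)"
        unfolding a_def by (intro add_left_mono mult_left_mono nn_integral_pressure_next) simp
      also have "ennreal (exp (- a) * \<psi>) * (ennreal a * ?P) = ennreal (exp (- a) * \<psi> * a) * ?P"
        using a0 by (simp add: \<psi>_def ennreal_mult mult_ac)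
      finally have "ennreal (exp (- a) * \<psi> * a) * ?P + ennreal (exp (- a) * \<psi>) * ?P \<le>
          ennreal (exp (- a) * \<psi> * a) * ?P + ?I"
        by (simp add: add.commute)
      then show ?thesis
        by (subst (asm) ennreal_add_left_cancel_le) (auto simp: emeasure_eq_measure ennreal_mult_eq_top_iff)
    qed
    \<comment> \<open>The last summand of the accumulated intake in \<open>\<psi>\<close>
      compensates exactly the intake part of \<open>a\<close>; the load part is the exponent of the
      current potential.\<close>
    moreover have "potential s n = exp (- a) * \<psi>"
      using conf by (simp add: potential_def \<psi>_def a_def mult_exp_exp algebra_simps power2_eq_square)
    ultimately show ?thesis unfolding const by simp
  qed
qed

text \<open>On \<open>F\<close> the potential starts at no less than
  \<open>exp (- (2 * m * \<alpha>))\<close>, since the intake factor is at least 1. Later it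
  vanishes after an exit and never exceeds \<open>exp (2 * m\<^sup>2 * exit_rate)\<close>. Growth of
  its mean thus bounds the probability of no exit from below by the quotient of the two, uniformly
  in time.\<close>

lemma prob_confined_forever:
  assumes S: "\<And>s. s \<in> S \<Longrightarrow> confined H s n \<and> load s n \<le> \<alpha>"
    and F: "F = {\<omega> \<in> space M. prune n (lab \<omega>) \<in> S}"
  shows "exp (- (2 * m * \<alpha>) - 2 * m\<^sup>2 * exit_rate) * prob F \<le>
    prob (F \<inter> {\<omega> \<in> space M. \<forall>k. confined H (lab \<omega>) k})"
proof -
  have FM [measurable]: "F \<in> sets M"
    using pred_prune[of "\<lambda>s. s \<in> S" n] by (simp add: F pred_def)
  note [measurable] = sets_prune
  define C where "C k = F \<inter> {\<omega> \<in> space M. confined H (lab \<omega>) (n + k)}" for k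
  have CM [measurable]: "C k \<in> sets M" for k unfolding C_def by measurable
  have incr: "(\<integral>\<^sup>+\<omega>. ennreal (potential (lab \<omega>) n) * indicator F \<omega> \<partial>M) \<le>
      (\<integral>\<^sup>+\<omega>. ennreal (potential (lab \<omega>) (n + k)) * indicator F \<omega> \<partial>M)" for k
  proof (induction k)
    case (Suc k)
    have "(\<integral>\<^sup>+\<omega>. ennreal (potential (lab \<omega>) (n + k)) * indicator F \<omega> \<partial>M) \<le>
        (\<integral>\<^sup>+\<omega>. ennreal (potential (lab \<omega>) (n + Suc k)) * indicator F \<omega> \<partial>M)"
    proof (rule nn_integral_mono_fibres[OF measurable_prune[of "n + k"] countable_Collect_finite])
      fix s :: "(vertex \<times> int) set"
      \<comment> \<open>\<open>F\<close> depends only on the state at time \<open>n\<close>, so each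
        fibre of the finer state at time \<open>n + k\<close> lies inside or outside
        \<open>F\<close>.\<close>
      have FI: "indicator F \<omega> * indicator (states (n + k) s) \<omega> =
          (if prune n s \<in> S then indicator (states (n + k) s) \<omega> else (0 :: ennreal))" for \<omega>
        by (auto simp: F indicator_def prune_prune)
      show "(\<integral>\<^sup>+\<omega>. ennreal (potential (lab \<omega>) (n + k)) * indicator F \<omega> * indicator (states (n + k) s) \<omega> \<partial>M)
        \<le> (\<integral>\<^sup>+\<omega>. ennreal (potential (lab \<omega>) (n + Suc k)) * indicator F \<omega> * indicator (states (n + k) s) \<omega> \<partial>M)"
        unfolding mult.assoc FI using potential_step[of "n + k" s]
        by (cases "prune n s \<in> S") simp_all
    qed measurable
    then show ?case using Suc by simp
  qed simp
  have bound: "exp (- (2 * m * \<alpha>) - 2 * m\<^sup>2 * exit_rate) * prob F \<le> prob (C k)" for k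
  proof -
    have "ennreal (exp (- (2 * m * \<alpha>))) * emeasure M F =
        (\<integral>\<^sup>+\<omega>. ennreal (exp (- (2 * m * \<alpha>))) * indicator F \<omega> \<partial>M)"
      by (simp add: nn_integral_cmult_indicator)
    also have "\<dots> \<le> (\<integral>\<^sup>+\<omega>. ennreal (potential (lab \<omega>) n) * indicator F \<omega> \<partial>M)"
    proof (rule nn_integral_mono)
      fix \<omega>
      have "exp (- (2 * m * \<alpha>)) \<le> potential (lab \<omega>) n" if "\<omega> \<in> F"
      proof -
        have "confined H (lab \<omega>) n" "load (lab \<omega>) n \<le> \<alpha>"
          using S[of "prune n (lab \<omega>)"] that by (auto simp: F confined_prune load_prune)
        have "0 \<le> (\<Sum>j<n. intake (lab \<omega>) j)"
          unfolding intake_def using exit_prob_bounds(1) by (intro sum_nonneg mult_nonneg_nonneg) auto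
        then have ge1: "1 \<le> exp (2 * m\<^sup>2 * (\<Sum>j<n. intake (lab \<omega>) j))" by simp
        from \<open>load (lab \<omega>) n \<le> \<alpha>\<close>
        have "exp (- (2 * m * \<alpha>)) \<le> exp (- (2 * m * load (lab \<omega>) n))"
          using m_nonneg by (simp add: mult_left_mono)
        from mult_mono[OF this ge1] \<open>confined H (lab \<omega>) n\<close>
        have "exp (- (2 * m * \<alpha>)) * 1 \<le> potential (lab \<omega>) n"
          by (simp add: potential_def)
        then show ?thesis by simp
      qed
      then show "ennreal (exp (- (2 * m * \<alpha>))) * indicator F \<omega> \<le> ennreal (potential (lab \<omega>) n) * indicator F \<omega>"
        by (auto simp: indicator_def intro: ennreal_leI)
    qed
    also have "\<dots> \<le> (\<integral>\<^sup>+\<omega>. ennreal (potential (lab \<omega>) (n + k)) * indicator F \<omega> \<partial>M)" by (rule incr)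
    also have "\<dots> \<le> (\<integral>\<^sup>+\<omega>. ennreal (exp (2 * m\<^sup>2 * exit_rate)) * indicator (C k) \<omega> \<partial>M)"
    proof (rule nn_integral_mono)
      fix \<omega> assume \<omega>: "\<omega> \<in> space M"
      have "potential (lab \<omega>) (n + k) \<le> exp (2 * m\<^sup>2 * exit_rate)"
      proof -
        have "0 \<le> load (lab \<omega>) (n + k)" unfolding load_def using exit_prob_bounds(1)
          by (intro sum_nonneg mult_nonneg_nonneg) auto
        then have "exp (- (2 * m * load (lab \<omega>) (n + k))) \<le> 1" using m_nonneg by simp
        moreover have "exp (2 * m\<^sup>2 * (\<Sum>j<n + k. intake (lab \<omega>) j)) \<le> exp (2 * m\<^sup>2 * exit_rate)"
          by (simp add: mult_left_mono sum_intake_le)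
        ultimately have "exp (- (2 * m * load (lab \<omega>) (n + k))) * exp (2 * m\<^sup>2 * (\<Sum>j<n + k. intake (lab \<omega>) j))
            \<le> 1 * exp (2 * m\<^sup>2 * exit_rate)"
          by (intro mult_mono) auto
        then show ?thesis by (simp add: potential_def)
      qed
      then have le: "ennreal (potential (lab \<omega>) (n + k)) \<le> ennreal (exp (2 * m\<^sup>2 * exit_rate))"
        by (rule ennreal_leI)
      show "ennreal (potential (lab \<omega>) (n + k)) * indicator F \<omega> \<le>
          ennreal (exp (2 * m\<^sup>2 * exit_rate)) * indicator (C k) \<omega>"
      proof (cases "\<omega> \<in> C k")
        case True
        then show ?thesis using le by (simp add: C_def)
      next
        case False
        then have "\<omega> \<notin> F \<or> potential (lab \<omega>) (n + k) = 0"
          using \<omega> by (simp add: C_def potential_def)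
        then show ?thesis by auto
      qed
    qed
    also have "\<dots> = ennreal (exp (2 * m\<^sup>2 * exit_rate)) * emeasure M (C k)"
      by (simp add: nn_integral_cmult_indicator)
    finally have "exp (- (2 * m * \<alpha>)) * prob F \<le> exp (2 * m\<^sup>2 * exit_rate) * prob (C k)"
      by (simp add: emeasure_eq_measure ennreal_le_iff flip: ennreal_mult)
    then show ?thesis by (simp add: exp_diff field_simps)
  qed
  have "(\<lambda>k. prob (C k)) \<longlonglongrightarrow> prob (\<Inter>k. C k)"
    by (intro finite_Lim_measure_decseq) (auto simp: decseq_def C_def intro: confined_antimono)
  then have "exp (- (2 * m * \<alpha>) - 2 * m\<^sup>2 * exit_rate) * prob F \<le> prob (\<Inter>k. C k)"
    by (rule LIMSEQ_le_const) (auto intro: bound)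
  also have "(\<Inter>k. C k) = F \<inter> {\<omega> \<in> space M. \<forall>k. confined H (lab \<omega>) k}"
    unfolding C_def using confined_antimono[of H _ "n + k" k for k] by fastforce
  finally show ?thesis .
qed

end

section \<open>Range and localisation\<close>

lemma visited_iff: "x \<in> visited T X \<longleftrightarrow> (\<exists>u\<in>T. X u = x)"
  by (auto simp: visited_def local_time_def truncate_def Let_def zero_enat_def card_gt_0_iff dest!: infinite_imp_nonempty)

text \<open>Generations are finite, so infinitely many visits amount to visits in arbitrarily late
  generations. This form is a countable combination of events.\<close>

lemma visited_infinitely_iff:
  "x \<in> visited_infinitely (kesten \<xi> \<omega>) X \<longleftrightarrow> (\<forall>n. \<exists>u\<in>kesten \<xi> \<omega>. n < length u \<and> X u = x)"
proof -
  have "infinite {u \<in> kesten \<xi> \<omega>. X u = x} \<longleftrightarrow> (\<forall>n. \<exists>u\<in>kesten \<xi> \<omega>. n < length u \<and> X u = x)"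
  proof
    assume inf: "infinite {u \<in> kesten \<xi> \<omega>. X u = x}"
    show "\<forall>n. \<exists>u\<in>kesten \<xi> \<omega>. n < length u \<and> X u = x"
    proof (rule allI, rule ccontr)
      fix n assume "\<not> (\<exists>u\<in>kesten \<xi> \<omega>. n < length u \<and> X u = x)"
      then have "{u \<in> kesten \<xi> \<omega>. X u = x} \<subseteq> truncate (kesten \<xi> \<omega>) (enat n)"
        by (auto simp: truncate_enat not_less[symmetric])
      then have "finite {u \<in> kesten \<xi> \<omega>. X u = x}"
        by (rule finite_subset) (rule finite_truncate_kesten)
      then show False using inf by simp
    qed
  next
    assume *: "\<forall>n. \<exists>u\<in>kesten \<xi> \<omega>. n < length u \<and> X u = x"
    show "infinite {u \<in> kesten \<xi> \<omega>. X u = x}"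
    proof
      assume fin: "finite {u \<in> kesten \<xi> \<omega>. X u = x}"
      from * obtain u where u: "u \<in> kesten \<xi> \<omega>" "X u = x"
        "Max (length ` {u \<in> kesten \<xi> \<omega>. X u = x}) < length u" by blast
      have "length u \<le> Max (length ` {u \<in> kesten \<xi> \<omega>. X u = x})"
        using fin u by (intro Max_ge) auto
      then show False using u by simp
    qed
  qed
  then show ?thesis
    by (auto simp: visited_infinitely_def local_time_def truncate_def Let_def)
qed

section \<open>Nearest-neighbour steps and geometric decay of the range\<close>

context vrbrw begin

text \<open>For \<open>H = UNIV\<close> the boundary is empty, so load and \<open>exit_rate\<close>
  are 0 and the lower bound for confinement equals 1.\<close>

lemma nearest_neighbour:
  assumes "summable (\<lambda>n. 1 / w n)"
  shows "AE \<omega> in M. \<forall>k. confined UNIV (labelled \<xi> X \<omega>) k"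
proof -
  have rim: "rim UNIV = {}" by (auto simp: rim_def)
  interpret vrbrw_region M \<mu> \<xi> w X UNIV
    by unfold_locales (auto simp: rim assms)
  have "exp (- (2 * m * 0) - 2 * m\<^sup>2 * exit_rate) * prob (space M) \<le>
      prob (space M \<inter> {\<omega> \<in> space M. \<forall>k. confined UNIV (lab \<omega>) k})"
    by (rule prob_confined_forever[where n = 0 and S = "{{([], 0)}}"])
      (auto simp: load_def rim prune_0, auto simp: confined_def)
  then have "prob {\<omega> \<in> space M. \<forall>k. confined UNIV (lab \<omega>) k} = 1"
    by (intro antisym) (simp_all add: exit_rate_def rim prob_space Int_absorb1)
  then show ?thesis by (subst (asm) prob_Collect_eq_1) auto
qed

text \<open>The sign \<open>\<epsilon>\<close> lets one argument serve both directions.\<close>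

definition hits :: "int \<Rightarrow> int \<Rightarrow> 'a set" where
  "hits \<epsilon> y = {\<omega> \<in> space M. \<exists>u. u \<in> kesten \<xi> \<omega> \<and> y \<le> \<epsilon> * X u \<omega>}"

lemma sets_hits [measurable]: "hits \<epsilon> y \<in> sets M"
proof -
  have [measurable]: "Measurable.pred M (\<lambda>\<omega>. y \<le> \<epsilon> * X u \<omega>)" for u
    by (rule measurable_compose[OF measurable_position]) simp
  show ?thesis unfolding hits_def by measurable
qed

text \<open>The constant of \<open>prob_confined_forever\<close> for zero load and a boundary
  consisting of one site.\<close>

definition confine_prob :: real where
  "confine_prob = exp (- (2 * reproduction_bound\<^sup>2 * (w 0 * (\<Sum>n. 1 / w n))))"

text \<open>Up to a null set, \<open>hits \<epsilon> y\<close> is split according to the first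
  generation reaching \<open>y\<close>. On each piece the barrier at \<open>y + 1\<close> is still
  unvisited, so the chance of never passing it is at least \<open>confine_prob\<close>, whatever the
  number of vertices at \<open>y\<close>.\<close>

lemma prob_hits_step:
  assumes sw: "summable (\<lambda>n. 1 / w n)" and \<epsilon>: "\<epsilon> = 1 \<or> \<epsilon> = - 1" and y: "0 \<le> y"
  shows "prob (hits \<epsilon> (y + 2)) \<le> (1 - confine_prob) * prob (hits \<epsilon> y)"
proof -
  define H where "H = {x. \<epsilon> * x \<le> y + 1}"
  have rim: "rim H = {\<epsilon> * (y + 1)}" using \<epsilon> by (auto simp: rim_def H_def)
  interpret vrbrw_region M \<mu> \<xi> w X H
  proof unfold_locales
    show "finite (rim H)" by (simp add: rim)
    show "x + 1 \<in> H \<or> x - 1 \<in> H" if "x \<in> H" for x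
      using \<epsilon> that by (auto simp: H_def)
  qed (rule sw)
  \<comment> \<open>States in which generation \<open>n\<close> is the first to reach
    \<open>y\<close>. The root's position is recorded because for \<open>n = 0\<close> there is no
    parent from which to bound it.\<close>
  define S where "S n = {s. confined UNIV s n \<and> (\<forall>x. ([], x) \<in> s \<longrightarrow> x = 0) \<and>
    (\<forall>u x. (u, x) \<in> s \<and> length u < n \<longrightarrow> \<epsilon> * x < y) \<and> (\<exists>u x. (u, x) \<in> s \<and> length u = n \<and> y \<le> \<epsilon> * x)}" for n
  define F where "F n = {\<omega> \<in> space M. prune n (lab \<omega>) \<in> S n}" for n
  have [measurable]: "F n \<in> sets M" for n
    using pred_prune[of "\<lambda>s. s \<in> S n" n] by (simp add: F_def pred_def)
  \<comment> \<open>There is no overshoot: a parent was still below \<open>y\<close> and steps have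
    length one, while the root sits at 0.\<close>
  have le_y: "\<epsilon> * x \<le> y" if s: "s \<in> S n" and ux: "(u, x) \<in> s" "length u \<le> n" for s n u x
  proof (cases "u = [] \<or> length u < n")
    case True
    then show ?thesis
    proof
      assume "u = []"
      then have "x = 0" using s ux(1) unfolding S_def by blast
      then show ?thesis using y by simp
    next
      assume "length u < n"
      then have "\<epsilon> * x < y" using s ux(1) unfolding S_def by blast
      then show ?thesis by simp
    qed
  next
    case False
    have "u = [] \<or> (\<exists>y'. (butlast u, y') \<in> s \<and> \<bar>x - y'\<bar> = 1)"
      using s ux by (auto simp: S_def confined_def)
    then obtain x' where x': "(butlast u, x') \<in> s" "\<bar>x - x'\<bar> = 1" using False by auto
    moreover have "length (butlast u) < n" using False ux(2) by (cases u rule: rev_cases) auto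
    ultimately have "\<epsilon> * x' < y" using s unfolding S_def by blast
    then show ?thesis using \<epsilon> x'(2) by auto
  qed
  have S: "confined H s n \<and> load s n \<le> 0" if s: "s \<in> S n" for s n
  proof
    have "x \<in> H" if "(u, x) \<in> s" "length u \<le> n" for u x
      using le_y[OF s that] by (simp add: H_def)
    then show "confined H s n" using s by (fastforce simp: S_def confined_def)
    have "{u. (u, \<epsilon> * (y + 1)) \<in> s \<and> length u = n} = {}"
      using le_y[OF s] \<epsilon> by fastforce
    then have "fresh s n (\<epsilon> * (y + 1)) = 0" by (simp only: fresh_def card.empty)
    then show "load s n \<le> 0" by (simp add: load_def rim)
  qed
  have rate: "exp (- (2 * m * 0) - 2 * m\<^sup>2 * exit_rate) = confine_prob"
    by (simp add: confine_prob_def exit_rate_def rim)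
  have Fle: "prob (F n \<inter> hits \<epsilon> (y + 2)) \<le> (1 - confine_prob) * prob (F n)" for n
  proof -
    let ?C = "F n \<inter> {\<omega> \<in> space M. \<forall>k. confined H (lab \<omega>) k}"
    have C [measurable]: "?C \<in> sets M" by measurable
    have "\<epsilon> * X u \<omega> \<le> y + 1" if "\<forall>k. confined H (lab \<omega>) k" "u \<in> kesten \<xi> \<omega>" for u \<omega>
      using that by (auto simp: confined_labelled H_def)
    then have "?C \<inter> hits \<epsilon> (y + 2) = {}" by (force simp: hits_def)
    then have "prob (F n \<inter> hits \<epsilon> (y + 2)) \<le> prob (F n - ?C)"
      by (intro finite_measure_mono) auto
    also have "\<dots> = prob (F n) - prob ?C"
      by (intro finite_measure_Diff) auto
    also have "\<dots> \<le> prob (F n) - confine_prob * prob (F n)"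
      using prob_confined_forever[where n = n and S = "S n" and \<alpha> = 0, OF S F_def] unfolding rate by simp
    finally show ?thesis by (simp add: algebra_simps)
  qed
  have disj: "disjoint_family F"
  proof -
    have "False" if "\<omega> \<in> F n" "\<omega> \<in> F k" "k < n" for \<omega> n k
    proof -
      have Sn: "prune n (lab \<omega>) \<in> S n" and Sk: "prune k (lab \<omega>) \<in> S k"
        using that by (simp_all add: F_def)
      from Sk obtain u x where ux: "(u, x) \<in> prune k (lab \<omega>)" "length u = k" "y \<le> \<epsilon> * x"
        unfolding S_def by auto
      have "(u, x) \<in> prune n (lab \<omega>)" "length u < n" using ux(1,2) that(3) by (simp_all add: prune_def)
      then have "\<epsilon> * x < y" using Sn unfolding S_def by blast
      then show False using ux(3) by simp
    qed
    then show ?thesis unfolding disjoint_family_on_def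
      by (metis Int_iff all_not_in_conv linorder_neqE_nat)
  qed
  have cover: "\<omega> \<in> (\<Union>n. F n)" if \<omega>: "\<omega> \<in> hits \<epsilon> y" and nn: "\<forall>k. confined UNIV (lab \<omega>) k" for \<omega>
  proof -
    let ?P = "\<lambda>n. \<exists>u\<in>kesten \<xi> \<omega>. length u = n \<and> y \<le> \<epsilon> * X u \<omega>"
    have sp: "\<omega> \<in> space M" using \<omega> by (simp add: hits_def)
    have "\<exists>n. ?P n" using \<omega> by (auto simp: hits_def)
    then obtain n where n: "?P n" and min: "\<And>k. k < n \<Longrightarrow> \<not> ?P k"
      using exists_least_iff[of ?P] by auto
    have "prune n (lab \<omega>) \<in> S n"
      unfolding S_def mem_Collect_eq
    proof (intro conjI allI impI)
      show "confined UNIV (prune n (lab \<omega>)) n" using nn by (simp add: confined_prune)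
      show "x = 0" if "([], x) \<in> prune n (lab \<omega>)" for x
        using that sp position_root by (auto simp: prune_def labelled_iff)
      show "\<epsilon> * x < y" if "(u, x) \<in> prune n (lab \<omega>) \<and> length u < n" for u x
        using that min[of "length u"] by (auto simp: prune_def labelled_iff not_le)
      show "\<exists>u x. (u, x) \<in> prune n (lab \<omega>) \<and> length u = n \<and> y \<le> \<epsilon> * x"
        using n by (auto simp: prune_def labelled_iff)
    qed
    then show ?thesis using sp by (auto simp: F_def)
  qed
  have "AE \<omega> in M. \<omega> \<in> hits \<epsilon> (y + 2) \<longrightarrow> \<omega> \<in> (\<Union>n. F n \<inter> hits \<epsilon> (y + 2))"
    using nearest_neighbour[OF sw]
  proof eventually_elim
    case (elim \<omega>)
    show ?case
    proof
      assume h: "\<omega> \<in> hits \<epsilon> (y + 2)"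
      then have "\<omega> \<in> hits \<epsilon> y" unfolding hits_def by force
      then show "\<omega> \<in> (\<Union>n. F n \<inter> hits \<epsilon> (y + 2))" using cover[OF _ elim] h by auto
    qed
  qed
  then have "prob (hits \<epsilon> (y + 2)) \<le> prob (\<Union>n. F n \<inter> hits \<epsilon> (y + 2))"
    by (rule finite_measure_mono_AE) measurable
  also have "\<dots> \<le> (1 - confine_prob) * prob (\<Union>n. F n)"
  proof (rule sums_le)
    show "(\<lambda>n. prob (F n \<inter> hits \<epsilon> (y + 2))) sums prob (\<Union>n. F n \<inter> hits \<epsilon> (y + 2))"
    proof (rule finite_measure_UNION)
      show "disjoint_family (\<lambda>n. F n \<inter> hits \<epsilon> (y + 2))"
        using disj unfolding disjoint_family_on_def by blast
    qed auto
    show "(\<lambda>n. (1 - confine_prob) * prob (F n)) sums ((1 - confine_prob) * prob (\<Union>n. F n))"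
      by (intro sums_mult finite_measure_UNION disj) auto
  qed (rule Fle)
  also have "\<dots> \<le> (1 - confine_prob) * prob (hits \<epsilon> y)"
  proof (rule mult_left_mono)
    have "F n \<subseteq> hits \<epsilon> y" for n
    proof
      fix \<omega> assume "\<omega> \<in> F n"
      then have "\<omega> \<in> space M" and "prune n (lab \<omega>) \<in> S n" by (simp_all add: F_def)
      moreover from this(2) obtain u x where "(u, x) \<in> prune n (lab \<omega>)" "y \<le> \<epsilon> * x"
        unfolding S_def by auto
      ultimately show "\<omega> \<in> hits \<epsilon> y" by (auto simp: hits_def prune_def labelled_iff)
    qed
    then have "(\<Union>n. F n) \<subseteq> hits \<epsilon> y" by blast
    then show "prob (\<Union>n. F n) \<le> prob (hits \<epsilon> y)" by (intro finite_measure_mono) auto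
    show "0 \<le> 1 - confine_prob"
      using weight_pos less_imp_le[OF weight_pos] by (simp add: confine_prob_def suminf_nonneg[OF sw])
  qed
  finally show ?thesis .
qed

text \<open>An infinite range means that for every \<open>k\<close> one of the two sides extends to
  \<open>2 * k\<close>, which has probability at most twice a geometric term. The event is
  identified exactly as a complement of measurable sets, so its measurability comes along.\<close>

lemma prob_finite_range:
  assumes sw: "summable (\<lambda>n. 1 / w n)"
  shows "prob {\<omega> \<in> space M. finite (visited (kesten \<xi> \<omega>) (\<lambda>u. X u \<omega>))} = 1"
proof -
  let ?q = "1 - confine_prob"
  let ?A = "\<lambda>k :: nat. hits 1 (2 * int k) \<union> hits (- 1) (2 * int k)"
  have q: "0 \<le> ?q" "?q < 1"
    using weight_pos less_imp_le[OF weight_pos] by (simp_all add: confine_prob_def suminf_nonneg[OF sw])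
  have geom: "prob (hits \<epsilon> (2 * int k)) \<le> ?q ^ k" if "\<epsilon> = 1 \<or> \<epsilon> = - 1" for \<epsilon> k
  proof (induction k)
    case (Suc k)
    have "prob (hits \<epsilon> (2 * int (Suc k))) \<le> ?q * prob (hits \<epsilon> (2 * int k))"
      using prob_hits_step[OF sw that, of "2 * int k"] by (simp add: algebra_simps)
    also have "\<dots> \<le> ?q * ?q ^ k" using q(1) by (intro mult_left_mono Suc)
    finally show ?case by simp
  qed simp
  have "prob (\<Inter>k. ?A k) \<le> 2 * ?q ^ k" for k
  proof -
    have "prob (\<Inter>k. ?A k) \<le> prob (?A k)" by (intro finite_measure_mono) auto
    also have "\<dots> \<le> prob (hits 1 (2 * int k)) + prob (hits (- 1) (2 * int k))"
      by (intro measure_Un_le) auto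
    also have "\<dots> \<le> 2 * ?q ^ k" using geom[of 1 k] geom[of "- 1" k] by simp
    finally show ?thesis .
  qed
  moreover have "(\<lambda>k. 2 * ?q ^ k) \<longlonglongrightarrow> 2 * 0"
    using q by (intro tendsto_mult tendsto_const LIMSEQ_realpow_zero)
  ultimately have "prob (\<Inter>k. ?A k) \<le> 0"
    by (intro LIMSEQ_le_const[where X = "\<lambda>k. 2 * ?q ^ k"]) auto
  then have "prob (space M - (\<Inter>k. ?A k)) = 1"
    by (subst prob_compl) (auto intro: antisym)
  also have "space M - (\<Inter>k. ?A k) = {\<omega> \<in> space M. finite (visited (kesten \<xi> \<omega>) (\<lambda>u. X u \<omega>))}"
  proof (intro equalityI subsetI)
    fix \<omega> assume "\<omega> \<in> space M - (\<Inter>k. ?A k)"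
    then obtain k where \<omega>: "\<omega> \<in> space M" and k: "\<omega> \<notin> hits 1 (2 * int k)" "\<omega> \<notin> hits (- 1) (2 * int k)" by auto
    have "\<bar>X u \<omega>\<bar> \<le> 2 * int k" if "u \<in> kesten \<xi> \<omega>" for u
      using k \<omega> that by (force simp: hits_def)
    then have "abs ` visited (kesten \<xi> \<omega>) (\<lambda>u. X u \<omega>) \<subseteq> {..2 * int k}"
      by (auto simp: visited_iff)
    then show "\<omega> \<in> {\<omega> \<in> space M. finite (visited (kesten \<xi> \<omega>) (\<lambda>u. X u \<omega>))}"
      using \<omega> finite_int_iff_bounded_le by auto
  next
    fix \<omega> assume "\<omega> \<in> {\<omega> \<in> space M. finite (visited (kesten \<xi> \<omega>) (\<lambda>u. X u \<omega>))}"
    then obtain K where \<omega>: "\<omega> \<in> space M" and sub: "abs ` visited (kesten \<xi> \<omega>) (\<lambda>u. X u \<omega>) \<subseteq> {..K}"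
      using finite_int_iff_bounded_le by auto
    have bound: "\<bar>X u \<omega>\<bar> \<le> K" if "u \<in> kesten \<xi> \<omega>" for u
    proof -
      have "X u \<omega> \<in> visited (kesten \<xi> \<omega>) (\<lambda>u. X u \<omega>)" using that by (auto simp: visited_iff)
      then show ?thesis using sub by auto
    qed
    \<comment> \<open>\<open>2 * Suc (nat K)\<close> exceeds \<open>K\<close> for either sign of
      \<open>K\<close>.\<close>
    have "\<omega> \<notin> ?A (Suc (nat K))"
    proof
      assume "\<omega> \<in> ?A (Suc (nat K))"
      then obtain u where u: "u \<in> kesten \<xi> \<omega>" "2 * int (Suc (nat K)) \<le> \<bar>X u \<omega>\<bar>"
        unfolding hits_def by auto
      show False using bound[OF u(1)] u(2) by (cases "0 \<le> K") simp_all
    qed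
    then show "\<omega> \<in> space M - (\<Inter>k. ?A k)" using \<omega> by blast
  qed
  finally show ?thesis .
qed

section \<open>Survival of the tree and localisation on two sites\<close>

lemma AE_spine:
  "AE \<omega> in M. \<forall>n. \<exists>u\<in>kesten \<xi> \<omega>. length u = n"
proof -
  have "AE \<omega> in M. snd (snd (\<xi> u \<omega>)) < fst (snd (\<xi> u \<omega>))" for u
  proof -
    have "AE z in distr M (count_space UNIV) (\<xi> u). snd (snd z) < fst (snd z)"
      unfolding distr_reproduction AE_measure_pmf_iff
      by (auto dest: special_law_index_less)
    then show ?thesis by (subst (asm) AE_distr_iff) auto
  qed
  then have "AE \<omega> in M. \<forall>u. snd (snd (\<xi> u \<omega>)) < fst (snd (\<xi> u \<omega>))"
    by (subst AE_all_countable) auto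
  then show ?thesis
  proof eventually_elim
    case (elim \<omega>)
    \<comment> \<open>The claim is strengthened to special vertices, since a normal vertex may be
      childless.\<close>
    have "\<exists>u\<in>kesten \<xi> \<omega>. length u = n \<and> special (\<lambda>u. \<xi> u \<omega>) u" for n
    proof (induction n)
      case 0
      show ?case by (intro bexI[of _ "[]"]) (auto simp: Nil_kesten special.root)
    next
      case (Suc n)
      then obtain u where u: "u \<in> kesten \<xi> \<omega>" "length u = n" "special (\<lambda>u. \<xi> u \<omega>) u" by auto
      then show ?case using elim
        by (intro bexI[of _ "u @ [snd (snd (\<xi> u \<omega>))]"])
          (auto simp: special_snoc kesten_def tree_snoc num_children_def case_prod_beta)
    qed
    then show ?case by blast
  qed
qed

lemma prob_two_sites:
  assumes sw: "summable (\<lambda>n. 1 / w n)"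
  shows "0 < prob {\<omega> \<in> space M. card (visited_infinitely (kesten \<xi> \<omega>) (\<lambda>u. X u \<omega>)) = 2}"
proof -
  let ?H = "{0, 1 :: int}"
  let ?V = "\<lambda>\<omega>. visited_infinitely (kesten \<xi> \<omega>) (\<lambda>u. X u \<omega>)"
  interpret vrbrw_region M \<mu> \<xi> w X ?H
    by unfold_locales (auto simp: rim_def sw)
  let ?G = "{\<omega> \<in> space M. \<forall>k. confined ?H (lab \<omega>) k}"
  \<comment> \<open>The root already sits on the boundary, so the initial load is not 0; being a
    fixed number, it still leaves a positive bound.\<close>
  have "0 < exp (- (2 * m * load {([], 0)} 0) - 2 * m\<^sup>2 * exit_rate) * prob (space M)"
    by (simp add: prob_space)
  also have "\<dots> \<le> prob (space M \<inter> ?G)"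
    by (rule prob_confined_forever[where n = 0 and S = "{{([], 0)}}"])
      (auto simp: prune_0, auto simp: confined_def)
  also have "\<dots> \<le> prob {\<omega> \<in> space M. card (?V \<omega>) = 2}"
  proof (rule finite_measure_mono_AE)
    note [measurable] = measurable_position
    have [measurable]: "Measurable.pred M (\<lambda>\<omega>. x \<in> ?V \<omega>)" for x
      unfolding visited_infinitely_iff Bex_def by measurable
    \<comment> \<open>Cardinality 2 is unfolded into quantifiers over the countable set of integers
      to make the event measurable.\<close>
    have "{\<omega> \<in> space M. card (?V \<omega>) = 2} =
        {\<omega> \<in> space M. \<exists>x y. x \<noteq> y \<and> (\<forall>z. z \<in> ?V \<omega> \<longleftrightarrow> z = x \<or> z = y)}"
      unfolding card_2_iff set_eq_iff by auto
    also have "\<dots> \<in> sets M" by measurable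
    finally show "{\<omega> \<in> space M. card (?V \<omega>) = 2} \<in> sets M" .
    show "AE \<omega> in M. \<omega> \<in> space M \<inter> ?G \<longrightarrow> \<omega> \<in> {\<omega> \<in> space M. card (?V \<omega>) = 2}"
      using AE_spine
    proof eventually_elim
      case (elim \<omega>)
      show ?case
      proof
        assume "\<omega> \<in> space M \<inter> ?G"
        then have \<omega>: "\<omega> \<in> space M" and conf: "\<And>k. confined ?H (lab \<omega>) k" by auto
        \<comment> \<open>On two adjacent sites every step switches sites, so the position is a
          function of the generation alone, starting from 0 at the root.\<close>
        have parity: "X u \<omega> = int (length u) mod 2" if "u \<in> kesten \<xi> \<omega>" for u
          using that
        proof (induction u rule: rev_induct)
          case Nil
          then show ?case using \<omega> by (simp add: position_root)
        next
          case (snoc i u)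
          then have "X u \<omega> = int (length u) mod 2" by (simp add: kesten_def tree_snoc)
          moreover have "X (u @ [i]) \<omega> \<in> ?H" "\<bar>X (u @ [i]) \<omega> - X u \<omega>\<bar> = 1"
            using conf[of "Suc (length u)"] snoc(2) by (auto simp: confined_labelled)
          ultimately show ?case by simp presburger
        qed
        have "?V \<omega> = ?H"
        proof (intro equalityI subsetI)
          fix x assume "x \<in> ?V \<omega>"
          then obtain u where "u \<in> kesten \<xi> \<omega>" "X u \<omega> = x" unfolding visited_infinitely_iff by blast
          then show "x \<in> ?H" using parity[of u] by simp presburger
        next
          fix x assume x: "x \<in> ?H"
          show "x \<in> ?V \<omega>"
            unfolding visited_infinitely_iff
          proof
            fix n
            \<comment> \<open>The length has the parity of \<open>x\<close> and exceeds
              \<open>n\<close>; survival of the tree provides a vertex in that generation.\<close>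
            obtain u where u: "u \<in> kesten \<xi> \<omega>" "length u = 2 * Suc n + nat x" using elim by blast
            then have "X u \<omega> = x" using parity[OF u(1)] x by auto
            then show "\<exists>u\<in>kesten \<xi> \<omega>. n < length u \<and> X u \<omega> = x" using u by (intro bexI[of _ u]) auto
          qed
        qed
        then show "\<omega> \<in> {\<omega> \<in> space M. card (?V \<omega>) = 2}" using \<omega> by simp
      qed
    qed
  qed
  finally show ?thesis .
qed

end

theorem proposition1p1:
  fixes M :: "'a measure" and \<mu> :: "nat pmf" and \<xi> :: "vertex \<Rightarrow> 'a \<Rightarrow> reproduction"
    and w :: "nat \<Rightarrow> real" and X :: "vertex \<Rightarrow> 'a \<Rightarrow> int"
  assumes "vrbrw M \<mu> \<xi> w X"
    and "summable (\<lambda>n. 1 / w n)"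
  shows "measure M {\<omega> \<in> space M. finite (visited (kesten \<xi> \<omega>) (\<lambda>u. X u \<omega>))} = 1 \<and>
    measure M {\<omega> \<in> space M. card (visited_infinitely (kesten \<xi> \<omega>) (\<lambda>u. X u \<omega>)) = 2} > 0"
  by (intro conjI vrbrw.prob_finite_range[OF assms] vrbrw.prob_two_sites[OF assms])

end
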